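(* Consider an adjunction $F\dashv G:\mathcal{D}\to\mathcal{C}$. (1) If $G$ is semiseparable and $e:\mathrm{Id}_{\mathcal{D}}\to\mathrm{Id}_{\mathcal{D}}$ is the associated idempotent natural transformation, then there is a unique functor $(K_{GF})_e:\mathcal{D}_e\to\mathcal{C}_{GF}$ such that $(K_{GF})_e\circ H=K_{GF}$ and $U_{GF}\circ(K_{GF})_e=G_e$. Moreover, the functor $(K_{GF})_e$ is an equivalence up to retracts. If $\mathcal{D}$ is idempotent complete, then $(K_{GF})_e$ is an equivalence of categories. (2) If $F$ is semiseparable and $e:\mathrm{Id}_{\mathcal{C}}\to\mathrm{Id}_{\mathcal{C}}$ is the associated idempotent natural transformation, then there is a unique functor $(K^{FG})_e:\mathcal{C}_e\to\mathcal{D}^{FG}$ such that $(K^{FG})_e\circ H=K^{FG}$ and $U^{FG}\circ(K^{FG})_e=F_e$. Moreover, the functor $(K^{FG})_e$ is an equivalence up to retracts. If $\mathcal{C}$ is idempotent complete, then $(K^{FG})_e$ is an equivalence of categories.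
   Context: Here $F:\mathcal{C}\to\mathcal{D}$ is left adjoint to $G:\mathcal{D}\to\mathcal{C}$, with unit $\eta$ and counit $\epsilon$. A functor $T:\mathcal{A}\to\mathcal{B}$ is semiseparable if there is a natural transformation $\mathcal{P}:\mathrm{Hom}_{\mathcal{B}}(T-,T-)\to\mathrm{Hom}_{\mathcal{A}}(-,-)$ with $\mathcal{T}\circ\mathcal{P}\circ\mathcal{T}=\mathcal{T}$, where $\mathcal{T}_{A,A'}(f)=T(f)$. To a semiseparable functor $T:\mathcal{A}\to\mathcal{B}$ is attached its associated idempotent natural transformation $e:\mathrm{Id}_{\mathcal{A}}\to\mathrm{Id}_{\mathcal{A}}$, given by $e_X=\mathcal{P}_{X,X}(\mathrm{Id}_{TX})$ for any such $\mathcal{P}$; it is the unique idempotent natural transformation with $Te=\mathrm{Id}_T$ such that for $f,g:A\to B$ in $\mathcal{A}$ one has $Tf=Tg$ iff $e_B\circ f=e_B\circ g$. For an idempotent natural transformation $e:\mathrm{Id}_{\mathcal{A}}\to\mathrm{Id}_{\mathcal{A}}$, the coidentifier $\mathcal{A}_e$ is the quotient category $\mathcal{A}/\!\sim$ with the same objects, where $f\sim g$ (for $f,g:A\to B$) iff $e_B\circ f=e_B\circ g$; $H:\mathcal{A}\to\mathcal{A}_e$ is the quotient functor (identity on objects, $f\mapsto\overline f$). If $T$ is semiseparable with associated idempotent $e$, then $T_e:\mathcal{A}_e\to\mathcal{B}$ denotes the unique functor with $T=T_e\circ H$. This defines $G_e:\mathcal{D}_e\to\mathcal{C}$ in (1)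 and $F_e:\mathcal{C}_e\to\mathcal{D}$ in (2). $\mathcal{C}_{GF}$ is the Eilenberg–Moore category of modules over the monad $(GF,G\epsilon F,\eta)$, with forgetful functor $U_{GF}:\mathcal{C}_{GF}\to\mathcal{C}$, and $\mathcal{D}^{FG}$ is the Eilenberg–Moore category of comodules over the comonad $(FG,F\eta G,\epsilon)$, with forgetful functor $U^{FG}:\mathcal{D}^{FG}\to\mathcal{D}$. The comparison functor is $K_{GF}:\mathcal{D}\to\mathcal{C}_{GF}$, $D\mapsto(GD,G\epsilon_D)$, $f\mapsto G(f)$; the cocomparison functor is $K^{FG}:\mathcal{C}\to\mathcal{D}^{FG}$, $C\mapsto(FC,F\eta_C)$, $f\mapsto F(f)$. A category is idempotent complete if all its idempotent morphisms split. The idempotent completion $\mathcal{A}^\natural$ has as objects the pairs $(X,e)$ with $e:X\to X$ idempotent in $\mathcal{A}$; a morphism $f:(X,e)\to(X',e')$ is a morphism $f:X\to X'$ with $f=e'\circ f\circ e$, and $\mathrm{Id}_{(X,e)}=e$. A functor $T:\mathcal{A}\to\mathcal{B}$ induces $T^\natural:\mathcal{A}^\natural\to\mathcal{B}^\natural$, $T^\natural(X,e)=(TX,Te)$, $T^\natural(f)=T(f)$, and $T$ is an equivalence up to retracts if $T^\natural$ is an equivalence. *)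

theory Defs
  imports "HOL-Library.FuncSet"
begin

text \<open>
  Objects and arrows are carrier sets inside HOL types; every arrow has one source and one target.
  Nothing is assumed about \<open>cmp\<close> on pairs that are not composable.
\<close>

record ('o, 'm) cat =
  Ob  :: "'o set"
  Arr :: "'m set"
  src :: "'m \<Rightarrow> 'o"
  tgt :: "'m \<Rightarrow> 'o"
  ide :: "'o \<Rightarrow> 'm"
  cmp :: "'m \<Rightarrow> 'm \<Rightarrow> 'm" (infixl "\<cdot>\<index>" 70)

definition hom :: "('o, 'm) cat \<Rightarrow> 'o \<Rightarrow> 'o \<Rightarrow> 'm set" where
  "hom A X Y = {f \<in> Arr A. src A f = X \<and> tgt A f = Y}"

locale category =
  fixes A :: "('o, 'm) cat" (structure)
  assumes src_in: "f \<in> Arr A \<Longrightarrow> src A f \<in> Ob A"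
    and tgt_in: "f \<in> Arr A \<Longrightarrow> tgt A f \<in> Ob A"
    and ide_in: "X \<in> Ob A \<Longrightarrow> ide A X \<in> hom A X X"
    and cmp_in: "f \<in> hom A X Y \<Longrightarrow> g \<in> hom A Y Z \<Longrightarrow> g \<cdot> f \<in> hom A X Z"
    and cmp_ide: "f \<in> hom A X Y \<Longrightarrow> f \<cdot> ide A X = f"
    and ide_cmp: "f \<in> hom A X Y \<Longrightarrow> ide A Y \<cdot> f = f"
    and assoc: "f \<in> hom A W X \<Longrightarrow> g \<in> hom A X Y \<Longrightarrow> h \<in> hom A Y Z \<Longrightarrow> h \<cdot> (g \<cdot> f) = h \<cdot> g \<cdot> f"

text \<open>
  The two maps of a functor are extensional (\<open>undefined\<close> off the carriers), so that HOL equality of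
  functor records is equality of functors and \<open>\<exists>!\<close> and \<open>THE\<close> can be used literally.
\<close>

record ('o, 'm, 'p, 'n) funct =
  fob :: "'o \<Rightarrow> 'p"
  far :: "'m \<Rightarrow> 'n"

definition is_functor ::
  "('o, 'm) cat \<Rightarrow> ('p, 'n) cat \<Rightarrow> ('o, 'm, 'p, 'n) funct \<Rightarrow> bool" where
  "is_functor A B T \<longleftrightarrow>
     category A \<and> category B \<and>
     fob T \<in> Ob A \<rightarrow>\<^sub>E Ob B \<and> far T \<in> Arr A \<rightarrow>\<^sub>E Arr B \<and>
     (\<forall>f\<in>Arr A. src B (far T f) = fob T (src A f) \<and> tgt B (far T f) = fob T (tgt A f)) \<and>
     (\<forall>X\<in>Ob A. far T (ide A X) = ide B (fob T X)) \<and>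
     (\<forall>f\<in>Arr A. \<forall>g\<in>Arr A. tgt A f = src A g \<longrightarrow> far T (g \<cdot>\<^bsub>A\<^esub> f) = far T g \<cdot>\<^bsub>B\<^esub> far T f)"

definition id_funct :: "('o, 'm) cat \<Rightarrow> ('o, 'm, 'o, 'm) funct" where
  "id_funct A = \<lparr>fob = (\<lambda>X\<in>Ob A. X), far = (\<lambda>f\<in>Arr A. f)\<rparr>"

text \<open>\<open>functor_comp A S T\<close> is \<open>S\<close> after \<open>T\<close>, where \<open>A\<close> is the source category of \<open>T\<close>.\<close>

definition functor_comp :: "('o, 'm) cat \<Rightarrow> ('p, 'n, 'q, 'k) funct \<Rightarrow> ('o, 'm, 'p, 'n) funct
    \<Rightarrow> ('o, 'm, 'q, 'k) funct" where
  "functor_comp A S T = \<lparr>fob = compose (Ob A) (fob S) (fob T), far = compose (Arr A) (far S) (far T)\<rparr>"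

definition nat_trans :: "('o, 'm) cat \<Rightarrow> ('p, 'n) cat \<Rightarrow> ('o, 'm, 'p, 'n) funct
    \<Rightarrow> ('o, 'm, 'p, 'n) funct \<Rightarrow> ('o \<Rightarrow> 'n) \<Rightarrow> bool" where
  "nat_trans A B S T t \<longleftrightarrow>
     is_functor A B S \<and> is_functor A B T \<and>
     (\<forall>X\<in>Ob A. t X \<in> hom B (fob S X) (fob T X)) \<and>
     (\<forall>X\<in>Ob A. \<forall>Y\<in>Ob A. \<forall>f\<in>hom A X Y. t Y \<cdot>\<^bsub>B\<^esub> far S f = far T f \<cdot>\<^bsub>B\<^esub> t X)"

definition is_iso :: "('o, 'm) cat \<Rightarrow> 'o \<Rightarrow> 'o \<Rightarrow> 'm \<Rightarrow> bool" where
  "is_iso A X Y f \<longleftrightarrow>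
     f \<in> hom A X Y \<and> (\<exists>g\<in>hom A Y X. g \<cdot>\<^bsub>A\<^esub> f = ide A X \<and> f \<cdot>\<^bsub>A\<^esub> g = ide A Y)"

definition nat_isomorphic :: "('o, 'm) cat \<Rightarrow> ('p, 'n) cat \<Rightarrow> ('o, 'm, 'p, 'n) funct
    \<Rightarrow> ('o, 'm, 'p, 'n) funct \<Rightarrow> bool" where
  "nat_isomorphic A B S T \<longleftrightarrow>
     (\<exists>t. nat_trans A B S T t \<and> (\<forall>X\<in>Ob A. is_iso B (fob S X) (fob T X) (t X)))"

definition is_equivalence ::
  "('o, 'm) cat \<Rightarrow> ('p, 'n) cat \<Rightarrow> ('o, 'm, 'p, 'n) funct \<Rightarrow> bool" where
  "is_equivalence A B T \<longleftrightarrow>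
     is_functor A B T \<and>
     (\<exists>S. is_functor B A S \<and>
          nat_isomorphic A A (functor_comp A S T) (id_funct A) \<and>
          nat_isomorphic B B (functor_comp B T S) (id_funct B))"

text \<open>\<open>adjunction C D F G \<eta> \<epsilon>\<close>: \<open>F : C \<rightarrow> D\<close> is left adjoint to \<open>G : D \<rightarrow> C\<close>.\<close>

definition adjunction :: "('c, 'cm) cat \<Rightarrow> ('d, 'dm) cat \<Rightarrow> ('c, 'cm, 'd, 'dm) funct
    \<Rightarrow> ('d, 'dm, 'c, 'cm) funct \<Rightarrow> ('c \<Rightarrow> 'cm) \<Rightarrow> ('d \<Rightarrow> 'dm) \<Rightarrow> bool" where
  "adjunction C D F G \<eta> \<epsilon> \<longleftrightarrow>
     is_functor C D F \<and> is_functor D C G \<and>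
     nat_trans C C (id_funct C) (functor_comp C G F) \<eta> \<and>
     nat_trans D D (functor_comp D F G) (id_funct D) \<epsilon> \<and>
     (\<forall>X\<in>Ob C. \<epsilon> (fob F X) \<cdot>\<^bsub>D\<^esub> far F (\<eta> X) = ide D (fob F X)) \<and>
     (\<forall>Y\<in>Ob D. far G (\<epsilon> Y) \<cdot>\<^bsub>C\<^esub> \<eta> (fob G Y) = ide C (fob G Y))"


subsection \<open>Semiseparable functors\<close>

text \<open>
  \<open>P X Y : Hom\<^sub>B(T X, T Y) \<rightarrow> Hom\<^sub>A(X, Y)\<close> is natural in \<open>X\<close> (contravariantly) and in \<open>Y\<close>;
  the last clause says \<open>\<T> \<circ> \<P> \<circ> \<T> = \<T>\<close>.
\<close>

definition semiseparating :: "('o, 'm) cat \<Rightarrow> ('p, 'n) cat \<Rightarrow> ('o, 'm, 'p, 'n) funct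
    \<Rightarrow> ('o \<Rightarrow> 'o \<Rightarrow> 'n \<Rightarrow> 'm) \<Rightarrow> bool" where
  "semiseparating A B T P \<longleftrightarrow>
     (\<forall>X\<in>Ob A. \<forall>Y\<in>Ob A. P X Y \<in> hom B (fob T X) (fob T Y) \<rightarrow> hom A X Y) \<and>
     (\<forall>X\<in>Ob A. \<forall>Y\<in>Ob A. \<forall>X'\<in>Ob A. \<forall>Y'\<in>Ob A.
        \<forall>h\<in>hom A X' X. \<forall>k\<in>hom A Y Y'. \<forall>g\<in>hom B (fob T X) (fob T Y).
          P X' Y' (far T k \<cdot>\<^bsub>B\<^esub> g \<cdot>\<^bsub>B\<^esub> far T h) = k \<cdot>\<^bsub>A\<^esub> P X Y g \<cdot>\<^bsub>A\<^esub> h) \<and>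
     (\<forall>X\<in>Ob A. \<forall>Y\<in>Ob A. \<forall>f\<in>hom A X Y. far T (P X Y (far T f)) = far T f)"

definition semiseparable ::
  "('o, 'm) cat \<Rightarrow> ('p, 'n) cat \<Rightarrow> ('o, 'm, 'p, 'n) funct \<Rightarrow> bool" where
  "semiseparable A B T \<longleftrightarrow> is_functor A B T \<and> (\<exists>P. semiseparating A B T P)"

definition associated_idempotent ::
  "('o, 'm) cat \<Rightarrow> ('p, 'n) cat \<Rightarrow> ('o, 'm, 'p, 'n) funct \<Rightarrow> ('o \<Rightarrow> 'm) \<Rightarrow> bool" where
  "associated_idempotent A B T e \<longleftrightarrow>
     (\<exists>P. semiseparating A B T P \<and> (\<forall>X\<in>Ob A. e X = P X X (ide B (fob T X))))"


subsection \<open>The coidentifier\<close>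

definition coid_rel :: "('o, 'm) cat \<Rightarrow> ('o \<Rightarrow> 'm) \<Rightarrow> ('m \<times> 'm) set" where
  "coid_rel A e = {(f, g). f \<in> Arr A \<and> g \<in> Arr A \<and> src A f = src A g \<and> tgt A f = tgt A g \<and>
     e (tgt A f) \<cdot>\<^bsub>A\<^esub> f = e (tgt A f) \<cdot>\<^bsub>A\<^esub> g}"

definition coidentifier :: "('o, 'm) cat \<Rightarrow> ('o \<Rightarrow> 'm) \<Rightarrow> ('o, 'm set) cat" where
  "coidentifier A e =
     \<lparr>Ob = Ob A,
      Arr = Arr A // coid_rel A e,
      src = (\<lambda>p. the_elem (src A ` p)),
      tgt = (\<lambda>p. the_elem (tgt A ` p)),
      ide = (\<lambda>X. coid_rel A e `` {ide A X}),
      cmp = (\<lambda>q p. \<Union>g\<in>q. \<Union>f\<in>p. coid_rel A e `` {g \<cdot>\<^bsub>A\<^esub> f})\<rparr>"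

definition quotient_functor :: "('o, 'm) cat \<Rightarrow> ('o \<Rightarrow> 'm) \<Rightarrow> ('o, 'm, 'o, 'm set) funct" where
  "quotient_functor A e =
     \<lparr>fob = (\<lambda>X\<in>Ob A. X), far = (\<lambda>f\<in>Arr A. coid_rel A e `` {f})\<rparr>"

text \<open>\<open>T\<^sub>e\<close>: the unique functor on the coidentifier with \<open>T\<^sub>e \<circ> H = T\<close>.\<close>

definition coid_functor :: "('o, 'm) cat \<Rightarrow> ('p, 'n) cat \<Rightarrow> ('o \<Rightarrow> 'm)
    \<Rightarrow> ('o, 'm, 'p, 'n) funct \<Rightarrow> ('o, 'm set, 'p, 'n) funct" where
  "coid_functor A B e T =
     (THE S. is_functor (coidentifier A e) B S \<and> functor_comp A S (quotient_functor A e) = T)"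


subsection \<open>Categories of objects with structure\<close>

text \<open>
  Modules, comodules and the idempotent completion all have as morphisms certain morphisms of a given
  category. Since one underlying morphism may be a morphism between several pairs of structured
  objects, it is tagged with its source and target: an arrow is a triple (source, morphism, target).
\<close>

definition tagged_cat :: "('o, 'm) cat \<Rightarrow> 's set \<Rightarrow> ('s \<Rightarrow> 's \<Rightarrow> 'm set) \<Rightarrow> ('s \<Rightarrow> 'm)
    \<Rightarrow> ('s, 's \<times> 'm \<times> 's) cat" where
  "tagged_cat A S H i =
     \<lparr>Ob = S,
      Arr = {(X, f, Y). X \<in> S \<and> Y \<in> S \<and> f \<in> H X Y},
      src = (\<lambda>(X, f, Y). X),
      tgt = (\<lambda>(X, f, Y). Y),
      ide = (\<lambda>X. (X, i X, X)),
      cmp = (\<lambda>(Y', g, Z) (X, f, Y). (X, g \<cdot>\<^bsub>A\<^esub> f, Z))\<rparr>"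

text \<open>Modules \<open>(X, m)\<close> over a monad \<open>(T, \<mu>, \<eta>)\<close>, where \<open>m : T X \<rightarrow> X\<close>.\<close>

definition EM_cat :: "('o, 'm) cat \<Rightarrow> ('o, 'm, 'o, 'm) funct \<Rightarrow> ('o \<Rightarrow> 'm) \<Rightarrow> ('o \<Rightarrow> 'm)
    \<Rightarrow> ('o \<times> 'm, ('o \<times> 'm) \<times> 'm \<times> ('o \<times> 'm)) cat" where
  "EM_cat C T \<mu> \<eta> = tagged_cat C
     {(X, m). X \<in> Ob C \<and> m \<in> hom C (fob T X) X \<and>
        m \<cdot>\<^bsub>C\<^esub> far T m = m \<cdot>\<^bsub>C\<^esub> \<mu> X \<and> m \<cdot>\<^bsub>C\<^esub> \<eta> X = ide C X}
     (\<lambda>(X, m) (X', m'). {f \<in> hom C X X'. f \<cdot>\<^bsub>C\<^esub> m = m' \<cdot>\<^bsub>C\<^esub> far T f})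
     (\<lambda>(X, m). ide C X)"

text \<open>Comodules \<open>(Y, w)\<close> over a comonad \<open>(W, \<delta>, \<epsilon>)\<close>, where \<open>w : Y \<rightarrow> W Y\<close>.\<close>

definition coEM_cat :: "('o, 'm) cat \<Rightarrow> ('o, 'm, 'o, 'm) funct \<Rightarrow> ('o \<Rightarrow> 'm) \<Rightarrow> ('o \<Rightarrow> 'm)
    \<Rightarrow> ('o \<times> 'm, ('o \<times> 'm) \<times> 'm \<times> ('o \<times> 'm)) cat" where
  "coEM_cat D W \<delta> \<epsilon> = tagged_cat D
     {(Y, w). Y \<in> Ob D \<and> w \<in> hom D Y (fob W Y) \<and>
        far W w \<cdot>\<^bsub>D\<^esub> w = \<delta> Y \<cdot>\<^bsub>D\<^esub> w \<and> \<epsilon> Y \<cdot>\<^bsub>D\<^esub> w = ide D Y}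
     (\<lambda>(Y, w) (Y', w'). {f \<in> hom D Y Y'. w' \<cdot>\<^bsub>D\<^esub> f = far W f \<cdot>\<^bsub>D\<^esub> w})
     (\<lambda>(Y, w). ide D Y)"

definition forgetful ::
  "('o \<times> 'm, ('o \<times> 'm) \<times> 'm \<times> ('o \<times> 'm)) cat
    \<Rightarrow> ('o \<times> 'm, ('o \<times> 'm) \<times> 'm \<times> ('o \<times> 'm), 'o, 'm) funct" where
  "forgetful E = \<lparr>fob = (\<lambda>(X, m)\<in>Ob E. X), far = (\<lambda>(M, f, N)\<in>Arr E. f)\<rparr>"

text \<open>The monad \<open>(GF, G\<epsilon>F, \<eta>)\<close> and the comonad \<open>(FG, F\<eta>G, \<epsilon>)\<close> of an adjunction.\<close>

definition modules_GF :: "('c, 'cm) cat \<Rightarrow> ('c, 'cm, 'd, 'dm) funct \<Rightarrow> ('d, 'dm, 'c, 'cm) funct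
    \<Rightarrow> ('c \<Rightarrow> 'cm) \<Rightarrow> ('d \<Rightarrow> 'dm) \<Rightarrow> ('c \<times> 'cm, ('c \<times> 'cm) \<times> 'cm \<times> ('c \<times> 'cm)) cat" where
  "modules_GF C F G \<eta> \<epsilon> = EM_cat C (functor_comp C G F) (\<lambda>X. far G (\<epsilon> (fob F X))) \<eta>"

definition comodules_FG :: "('d, 'dm) cat \<Rightarrow> ('c, 'cm, 'd, 'dm) funct \<Rightarrow> ('d, 'dm, 'c, 'cm) funct
    \<Rightarrow> ('c \<Rightarrow> 'cm) \<Rightarrow> ('d \<Rightarrow> 'dm) \<Rightarrow> ('d \<times> 'dm, ('d \<times> 'dm) \<times> 'dm \<times> ('d \<times> 'dm)) cat" where
  "comodules_FG D F G \<eta> \<epsilon> = coEM_cat D (functor_comp D F G) (\<lambda>Y. far F (\<eta> (fob G Y))) \<epsilon>"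

definition comparison :: "('d, 'dm) cat \<Rightarrow> ('d, 'dm, 'c, 'cm) funct \<Rightarrow> ('d \<Rightarrow> 'dm)
    \<Rightarrow> ('d, 'dm, 'c \<times> 'cm, ('c \<times> 'cm) \<times> 'cm \<times> ('c \<times> 'cm)) funct" where
  "comparison D G \<epsilon> =
     \<lparr>fob = (\<lambda>Y\<in>Ob D. (fob G Y, far G (\<epsilon> Y))),
      far = (\<lambda>f\<in>Arr D. ((fob G (src D f), far G (\<epsilon> (src D f))),
                        far G f,
                        (fob G (tgt D f), far G (\<epsilon> (tgt D f)))))\<rparr>"

definition cocomparison :: "('c, 'cm) cat \<Rightarrow> ('c, 'cm, 'd, 'dm) funct \<Rightarrow> ('c \<Rightarrow> 'cm)
    \<Rightarrow> ('c, 'cm, 'd \<times> 'dm, ('d \<times> 'dm) \<times> 'dm \<times> ('d \<times> 'dm)) funct" where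
  "cocomparison C F \<eta> =
     \<lparr>fob = (\<lambda>X\<in>Ob C. (fob F X, far F (\<eta> X))),
      far = (\<lambda>f\<in>Arr C. ((fob F (src C f), far F (\<eta> (src C f))),
                        far F f,
                        (fob F (tgt C f), far F (\<eta> (tgt C f)))))\<rparr>"


subsection \<open>Idempotent completion\<close>

definition idempotent_complete :: "('o, 'm) cat \<Rightarrow> bool" where
  "idempotent_complete A \<longleftrightarrow>
     (\<forall>X\<in>Ob A. \<forall>f\<in>hom A X X. f \<cdot>\<^bsub>A\<^esub> f = f \<longrightarrow>
        (\<exists>Y\<in>Ob A. \<exists>p\<in>hom A X Y. \<exists>i\<in>hom A Y X. i \<cdot>\<^bsub>A\<^esub> p = f \<and> p \<cdot>\<^bsub>A\<^esub> i = ide A Y))"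

definition idem_completion ::
  "('o, 'm) cat \<Rightarrow> ('o \<times> 'm, ('o \<times> 'm) \<times> 'm \<times> ('o \<times> 'm)) cat" where
  "idem_completion A = tagged_cat A
     {(X, u). X \<in> Ob A \<and> u \<in> hom A X X \<and> u \<cdot>\<^bsub>A\<^esub> u = u}
     (\<lambda>(X, u) (X', u'). {f \<in> hom A X X'. f = u' \<cdot>\<^bsub>A\<^esub> f \<cdot>\<^bsub>A\<^esub> u})
     (\<lambda>(X, u). u)"

definition idem_completion_functor ::
  "('o, 'm) cat \<Rightarrow> ('o, 'm, 'p, 'n) funct
    \<Rightarrow> ('o \<times> 'm, ('o \<times> 'm) \<times> 'm \<times> ('o \<times> 'm), 'p \<times> 'n, ('p \<times> 'n) \<times> 'n \<times> ('p \<times> 'n)) funct" where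
  "idem_completion_functor A T =
     \<lparr>fob = (\<lambda>(X, u)\<in>Ob (idem_completion A). (fob T X, far T u)),
      far = (\<lambda>((X, u), f, (X', u'))\<in>Arr (idem_completion A).
               ((fob T X, far T u), far T f, (fob T X', far T u')))\<rparr>"

definition equivalence_up_to_retracts ::
  "('o, 'm) cat \<Rightarrow> ('p, 'n) cat \<Rightarrow> ('o, 'm, 'p, 'n) funct \<Rightarrow> bool" where
  "equivalence_up_to_retracts A B T \<longleftrightarrow>
     is_functor A B T \<and>
     is_equivalence (idem_completion A) (idem_completion B) (idem_completion_functor A T)"

end

theory Submission
  imports Defs
begin

text \<open>
  If \<open>G\<close> is semiseparable through \<open>P\<close>, then \<open>e\<^sub>Y \<cdot> f = P (G f)\<close>, so \<open>G\<close> identifies exactly the arrows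
  identified in the coidentifier and the comparison functor factors faithfully through it. It is full:
  for a module morphism \<open>g\<close> the arrow \<open>P g\<close> satisfies \<open>G (P g) \<cdot> G\<epsilon> = g \<cdot> G\<epsilon>\<close>, and \<open>G\<epsilon>\<close> is split by \<open>\<eta>\<close>.
  Every module \<open>(X, m)\<close> is a retract of the free module on \<open>X\<close>: the arrows \<open>\<gamma>\<^sub>Y = P (\<eta>\<^sub>G\<^sub>Y) : Y \<rightarrow> FGY\<close>
  are natural with \<open>\<epsilon>\<^sub>Y \<cdot> \<gamma>\<^sub>Y = e\<^sub>Y\<close>, and \<open>GFm \<cdot> G\<gamma>\<^sub>F\<^sub>X \<cdot> \<eta>\<^sub>X\<close> is a section of \<open>m\<close> in modules.
  A fully faithful functor whose objects reach every object up to retracts is an equivalence up to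
  retracts, and an equivalence if idempotents split in its source; idempotents of the coidentifier lift
  to \<open>\<D>\<close> as \<open>e \<cdot> f\<close>, so they split if those of \<open>\<D>\<close> do. The second half is dual.
\<close>

section \<open>Categories and functors\<close>

context category
begin

lemma arr_cmp [simp]:
  assumes "f \<in> Arr A" "g \<in> Arr A" "tgt A f = src A g"
  shows "g \<cdot> f \<in> Arr A" "src A (g \<cdot> f) = src A f" "tgt A (g \<cdot> f) = tgt A g"
  using cmp_in[of f "src A f" "tgt A f" g "tgt A g"] assms by (auto simp: hom_def)

lemma arr_ide [simp]:
  assumes "X \<in> Ob A"
  shows "ide A X \<in> Arr A" "src A (ide A X) = X" "tgt A (ide A X) = X"
  using ide_in[OF assms] by (auto simp: hom_def)

lemma cmp_arr_ide [simp]: "f \<in> Arr A \<Longrightarrow> src A f = X \<Longrightarrow> f \<cdot> ide A X = f"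
  using cmp_ide[of f X "tgt A f"] by (simp add: hom_def)

lemma cmp_ide_arr [simp]: "f \<in> Arr A \<Longrightarrow> tgt A f = Y \<Longrightarrow> ide A Y \<cdot> f = f"
  using ide_cmp[of f "src A f" Y] by (simp add: hom_def)

text \<open>Oriented so that rewriting brings every composite into left-nested form, the reading of
  the \<open>infixl\<close> notation.\<close>

lemma cmp_assoc:
  "f \<in> Arr A \<Longrightarrow> g \<in> Arr A \<Longrightarrow> h \<in> Arr A \<Longrightarrow> tgt A f = src A g \<Longrightarrow> tgt A g = src A h
    \<Longrightarrow> h \<cdot> (g \<cdot> f) = h \<cdot> g \<cdot> f"
  using assoc[of f "src A f" "tgt A f" g "tgt A g" h "tgt A h"] by (simp add: hom_def)

lemmas arr_ob [simp] = src_in tgt_in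

lemma hom_ob: "f \<in> hom A X Y \<Longrightarrow> X \<in> Ob A \<and> Y \<in> Ob A"
  by (auto simp: hom_def)

end

lemma homD: "f \<in> hom A X Y \<Longrightarrow> f \<in> Arr A \<and> src A f = X \<and> tgt A f = Y"
  by (simp add: hom_def)

lemma homI: "f \<in> Arr A \<Longrightarrow> src A f = X \<Longrightarrow> tgt A f = Y \<Longrightarrow> f \<in> hom A X Y"
  by (simp add: hom_def)

locale functor_between = dom: category A + cod: category B
  for A :: "('o, 'm) cat" and B :: "('p, 'n) cat" +
  fixes T :: "('o, 'm, 'p, 'n) funct"
  assumes is_functor: "is_functor A B T"
begin

lemma fob_in [simp]: "X \<in> Ob A \<Longrightarrow> fob T X \<in> Ob B"
  using is_functor by (auto simp: is_functor_def)

lemma far_arr [simp]: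
  assumes "f \<in> Arr A"
  shows "far T f \<in> Arr B" "src B (far T f) = fob T (src A f)" "tgt B (far T f) = fob T (tgt A f)"
  using is_functor assms by (auto simp: is_functor_def)

lemma far_ide [simp]: "X \<in> Ob A \<Longrightarrow> far T (ide A X) = ide B (fob T X)"
  using is_functor by (auto simp: is_functor_def)

lemma far_cmp [simp]:
  "f \<in> Arr A \<Longrightarrow> g \<in> Arr A \<Longrightarrow> tgt A f = src A g \<Longrightarrow> far T (g \<cdot>\<^bsub>A\<^esub> f) = far T g \<cdot>\<^bsub>B\<^esub> far T f"
  using is_functor by (auto simp: is_functor_def)

lemma far_hom: "f \<in> hom A X Y \<Longrightarrow> far T f \<in> hom B (fob T X) (fob T Y)"
  by (auto simp: hom_def)

lemma fob_undefined: "X \<notin> Ob A \<Longrightarrow> fob T X = undefined"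
  and far_undefined: "f \<notin> Arr A \<Longrightarrow> far T f = undefined"
  using is_functor by (auto simp: is_functor_def)

end

lemma functor_betweenI: "is_functor A B T \<Longrightarrow> functor_between A B T"
  by (simp add: functor_between_def functor_between_axioms_def is_functor_def)

lemma is_functorI:
  assumes "category A" "category B"
    and "\<And>X. X \<in> Ob A \<Longrightarrow> fob T X \<in> Ob B"
    and "\<And>X. X \<notin> Ob A \<Longrightarrow> fob T X = undefined"
    and "\<And>f. f \<in> Arr A \<Longrightarrow> far T f \<in> hom B (fob T (src A f)) (fob T (tgt A f))"
    and "\<And>f. f \<notin> Arr A \<Longrightarrow> far T f = undefined"
    and "\<And>X. X \<in> Ob A \<Longrightarrow> far T (ide A X) = ide B (fob T X)"
    and "\<And>f g. f \<in> Arr A \<Longrightarrow> g \<in> Arr A \<Longrightarrow> tgt A f = src A g \<Longrightarrow>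
      far T (g \<cdot>\<^bsub>A\<^esub> f) = far T g \<cdot>\<^bsub>B\<^esub> far T f"
  shows "is_functor A B T"
  using assms by (auto simp: is_functor_def hom_def intro!: PiE_I)

lemma funct_eqI:
  assumes "is_functor A B S" "is_functor A B T"
    and "\<And>X. X \<in> Ob A \<Longrightarrow> fob S X = fob T X"
    and "\<And>f. f \<in> Arr A \<Longrightarrow> far S f = far T f"
  shows "S = T"
proof -
  interpret S: functor_between A B S by (rule functor_betweenI) fact
  interpret T: functor_between A B T by (rule functor_betweenI) fact
  have "fob S = fob T"
    using assms(3) S.fob_undefined T.fob_undefined by (metis ext)
  moreover have "far S = far T"
    using assms(4) S.far_undefined T.far_undefined by (metis ext)
  ultimately show ?thesis by simp
qed

lemma is_functor_comp:
  assumes "is_functor A B T" "is_functor B E S"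
  shows "is_functor A E (functor_comp A S T)"
proof -
  interpret T: functor_between A B T by (rule functor_betweenI) fact
  interpret S: functor_between B E S by (rule functor_betweenI) fact
  show ?thesis
    by (rule is_functorI) (auto simp: functor_comp_def compose_def hom_def
        T.dom.category_axioms S.cod.category_axioms)
qed

lemma is_functor_id: "category A \<Longrightarrow> is_functor A A (id_funct A)"
proof -
  assume "category A"
  then interpret category A .
  show ?thesis
    by (rule is_functorI) (auto simp: id_funct_def hom_def category_axioms)
qed

lemma functor_comp_simps [simp]:
  "X \<in> Ob A \<Longrightarrow> fob (functor_comp A S T) X = fob S (fob T X)"
  "f \<in> Arr A \<Longrightarrow> far (functor_comp A S T) f = far S (far T f)"
  by (auto simp: functor_comp_def compose_def)

lemma id_funct_simps [simp]:
  "X \<in> Ob A \<Longrightarrow> fob (id_funct A) X = X"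
  "f \<in> Arr A \<Longrightarrow> far (id_funct A) f = f"
  by (auto simp: id_funct_def)

text \<open>\<open>T\<close> has to map the carriers of \<open>A\<close> into those of
  \<open>B\<close>, because \<open>functor_comp B S R\<close> takes its proper values only
  there.\<close>

lemma functor_comp_assoc:
  assumes "is_functor A B T"
  shows "functor_comp A S (functor_comp A R T) = functor_comp A (functor_comp B S R) T"
proof -
  interpret functor_between A B T by (rule functor_betweenI) fact
  show ?thesis by (auto simp: functor_comp_def compose_def fun_eq_iff)
qed

section \<open>Fully faithful functors\<close>

locale fully_faithful = functor_between +
  assumes full: "X \<in> Ob A \<Longrightarrow> Y \<in> Ob A \<Longrightarrow> g \<in> hom B (fob T X) (fob T Y) \<Longrightarrow>
      \<exists>f\<in>hom A X Y. far T f = g"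
    and faithful: "f \<in> hom A X Y \<Longrightarrow> f' \<in> hom A X Y \<Longrightarrow> far T f = far T f' \<Longrightarrow> f = f'"
begin

text \<open>Choose for each \<open>Z\<close> an object \<open>R Z\<close> and an isomorphism
  \<open>\<phi> Z\<close> from its image to \<open>Z\<close>. Conjugation by \<open>\<phi>\<close>
  followed by lifting along \<open>T\<close> is a quasi-inverse; every equation between lifts is
  checked after applying \<open>T\<close>, by faithfulness.\<close>

lemma equivalence_if_essentially_surjective:
  assumes "\<And>Z. Z \<in> Ob B \<Longrightarrow> \<exists>X\<in>Ob A. \<exists>f. is_iso B (fob T X) Z f"
  shows "is_equivalence A B T"
proof -
  have "\<forall>Z\<in>Ob B. \<exists>X f g. X \<in> Ob A \<and> f \<in> hom B (fob T X) Z \<and> g \<in> hom B Z (fob T X)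
      \<and> g \<cdot>\<^bsub>B\<^esub> f = ide B (fob T X) \<and> f \<cdot>\<^bsub>B\<^esub> g = ide B Z"
    using assms unfolding is_iso_def by blast
  then obtain R \<phi> \<psi> where R [simp]: "Z \<in> Ob B \<Longrightarrow> R Z \<in> Ob A"
    and \<phi>: "Z \<in> Ob B \<Longrightarrow> \<phi> Z \<in> hom B (fob T (R Z)) Z"
    and \<psi>: "Z \<in> Ob B \<Longrightarrow> \<psi> Z \<in> hom B Z (fob T (R Z))"
    and \<psi>\<phi>: "Z \<in> Ob B \<Longrightarrow> \<psi> Z \<cdot>\<^bsub>B\<^esub> \<phi> Z = ide B (fob T (R Z))"
    and \<phi>\<psi>: "Z \<in> Ob B \<Longrightarrow> \<phi> Z \<cdot>\<^bsub>B\<^esub> \<psi> Z = ide B Z" for Z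
    by metis
  note [simp] = homD[OF \<phi>] homD[OF \<psi>]
  \<comment> \<open>\<open>l X Y g\<close> is a chosen preimage of \<open>g\<close>, which exists by
    fullness.\<close>
  define l where "l X Y g = (SOME f. f \<in> hom A X Y \<and> far T f = g)" for X Y g
  have l: "l X Y g \<in> hom A X Y" "far T (l X Y g) = g"
    if "X \<in> Ob A" "Y \<in> Ob A" "g \<in> hom B (fob T X) (fob T Y)" for X Y g
    using someI_ex[of "\<lambda>f. f \<in> hom A X Y \<and> far T f = g"] full[OF that] unfolding l_def by blast+
  \<comment> \<open>\<open>c g\<close> is \<open>g\<close> transported along \<open>\<phi>\<close>
    to an arrow between objects in the image of \<open>T\<close>.\<close>
  define c where "c g = \<psi> (tgt B g) \<cdot>\<^bsub>B\<^esub> g \<cdot>\<^bsub>B\<^esub> \<phi> (src B g)" for g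
  have c: "c g \<in> hom B (fob T (R (src B g))) (fob T (R (tgt B g)))" if "g \<in> Arr B" for g
    using that by (simp add: c_def hom_def)
  define S where "S = \<lparr>fob = restrict R (Ob B),
    far = (\<lambda>g\<in>Arr B. l (R (src B g)) (R (tgt B g)) (c g))\<rparr>"
  have fobS [simp]: "fob S Z = R Z" if "Z \<in> Ob B" for Z
    using that by (simp add: S_def)
  have farS: "far S g \<in> hom A (R (src B g)) (R (tgt B g))" and TS: "far T (far S g) = c g"
    if "g \<in> Arr B" for g
    using l[OF _ _ c[OF that]] that by (simp_all add: S_def)
  note [simp] = homD[OF farS]
  have \<phi>c: "\<phi> (tgt B g) \<cdot>\<^bsub>B\<^esub> c g = g \<cdot>\<^bsub>B\<^esub> \<phi> (src B g)" if "g \<in> Arr B" for g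
    using that by (simp add: c_def cod.cmp_assoc \<phi>\<psi>)
  \<comment> \<open>\<open>\<phi> Z\<close> cancels on the left since \<open>\<psi> Z\<close> is a
    left inverse of it.\<close>
  have \<phi>_mono: "u = v" if "u \<in> hom B W (fob T (R Z))" "v \<in> hom B W (fob T (R Z))" "Z \<in> Ob B"
    "\<phi> Z \<cdot>\<^bsub>B\<^esub> u = \<phi> Z \<cdot>\<^bsub>B\<^esub> v" for u v W Z
  proof -
    have "\<psi> Z \<cdot>\<^bsub>B\<^esub> \<phi> Z \<cdot>\<^bsub>B\<^esub> u = \<psi> Z \<cdot>\<^bsub>B\<^esub> \<phi> Z \<cdot>\<^bsub>B\<^esub> v"
      using that by (simp add: hom_def flip: cod.cmp_assoc)
    then show ?thesis using that by (simp add: \<psi>\<phi> hom_def)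
  qed
  have S: "is_functor B A S"
  proof (rule is_functorI)
    fix X assume X: "X \<in> Ob B"
    show "far S (ide B X) = ide A (fob S X)"
      by (rule faithful[of _ "R X" "R X"]) (use X in \<open>auto simp: TS c_def \<psi>\<phi> hom_def\<close>)
  next
    fix f g assume f: "f \<in> Arr B" "g \<in> Arr B" "tgt B f = src B g"
    \<comment> \<open>Multiplicativity of \<open>c\<close> is tested after composing with
      \<open>\<phi>\<close>: by \<open>\<phi>c\<close>, both sides become \<open>g\<close> after
      \<open>f\<close> after \<open>\<phi> (src B f)\<close>.\<close>
    have "\<phi> (tgt B g) \<cdot>\<^bsub>B\<^esub> c (g \<cdot>\<^bsub>B\<^esub> f) = g \<cdot>\<^bsub>B\<^esub> f \<cdot>\<^bsub>B\<^esub> \<phi> (src B f)"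
      using f \<phi>c[of "g \<cdot>\<^bsub>B\<^esub> f"] by simp
    moreover have "\<phi> (tgt B g) \<cdot>\<^bsub>B\<^esub> (c g \<cdot>\<^bsub>B\<^esub> c f) = g \<cdot>\<^bsub>B\<^esub> (\<phi> (tgt B f) \<cdot>\<^bsub>B\<^esub> c f)"
      using f homD[OF c[OF f(1)]] homD[OF c[OF f(2)]] by (simp add: cod.cmp_assoc \<phi>c)
    ultimately have eq: "\<phi> (tgt B g) \<cdot>\<^bsub>B\<^esub> c (g \<cdot>\<^bsub>B\<^esub> f) = \<phi> (tgt B g) \<cdot>\<^bsub>B\<^esub> (c g \<cdot>\<^bsub>B\<^esub> c f)"
      using f \<phi>c[OF f(1)] by (simp add: cod.cmp_assoc)
    have gf: "g \<cdot>\<^bsub>B\<^esub> f \<in> Arr B" "src B (g \<cdot>\<^bsub>B\<^esub> f) = src B f" "tgt B (g \<cdot>\<^bsub>B\<^esub> f) = tgt B g"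
      using f by simp_all
    have "c (g \<cdot>\<^bsub>B\<^esub> f) = c g \<cdot>\<^bsub>B\<^esub> c f"
    proof (rule \<phi>_mono[OF _ _ _ eq])
      show "c (g \<cdot>\<^bsub>B\<^esub> f) \<in> hom B (fob T (R (src B f))) (fob T (R (tgt B g)))"
        using c[OF gf(1)] gf by simp
      show "c g \<cdot>\<^bsub>B\<^esub> c f \<in> hom B (fob T (R (src B f))) (fob T (R (tgt B g)))"
        using c[OF f(1)] c[OF f(2)] f(3) by (metis cod.cmp_in)
    qed (use f in simp)
    then have "far T (far S (g \<cdot>\<^bsub>B\<^esub> f)) = far T (far S g \<cdot>\<^bsub>A\<^esub> far S f)"
      using f gf by (simp add: TS)
    moreover have "far S (g \<cdot>\<^bsub>B\<^esub> f) \<in> hom A (R (src B f)) (R (tgt B g))"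
      using farS[OF gf(1)] gf by simp
    moreover have "far S g \<cdot>\<^bsub>A\<^esub> far S f \<in> hom A (R (src B f)) (R (tgt B g))"
      using farS[OF f(1)] farS[OF f(2)] f(3) by (metis dom.cmp_in)
    ultimately show "far S (g \<cdot>\<^bsub>B\<^esub> f) = far S g \<cdot>\<^bsub>A\<^esub> far S f"
      using faithful by blast
  qed (auto simp: dom.category_axioms cod.category_axioms farS, auto simp: S_def)
  have counit: "nat_isomorphic B B (functor_comp B T S) (id_funct B)"
    unfolding nat_isomorphic_def
  proof (intro exI conjI ballI)
    show "nat_trans B B (functor_comp B T S) (id_funct B) \<phi>"
      unfolding nat_trans_def
      using is_functor_comp[OF S is_functor] is_functor_id[OF cod.category_axioms] \<phi> \<phi>c
      by (auto simp: hom_def TS)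
    show "is_iso B (fob (functor_comp B T S) Z) (fob (id_funct B) Z) (\<phi> Z)" if "Z \<in> Ob B" for Z
      unfolding is_iso_def using that \<phi>[OF that] \<psi>[OF that] \<phi>\<psi>[OF that] \<psi>\<phi>[OF that] by auto
  qed
  \<comment> \<open>The other isomorphism lifts \<open>\<phi>\<close> and \<open>\<psi>\<close> at
    the objects \<open>fob T X\<close>; faithfulness makes the lifts natural and mutually
    inverse.\<close>
  define u where "u X = l (R (fob T X)) X (\<phi> (fob T X))" for X
  define v where "v X = l X (R (fob T X)) (\<psi> (fob T X))" for X
  have u: "u X \<in> hom A (R (fob T X)) X" "far T (u X) = \<phi> (fob T X)"
    and v: "v X \<in> hom A X (R (fob T X))" "far T (v X) = \<psi> (fob T X)" if "X \<in> Ob A" for X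
    using that l \<phi> \<psi> by (simp_all add: u_def v_def)
  note [simp] = homD[OF u(1)] homD[OF v(1)] u(2) v(2)
  have unit: "nat_isomorphic A A (functor_comp A S T) (id_funct A)"
    unfolding nat_isomorphic_def
  proof (intro exI conjI ballI)
    have "u Y \<cdot>\<^bsub>A\<^esub> far S (far T f) = f \<cdot>\<^bsub>A\<^esub> u X" if "f \<in> hom A X Y" for f X Y
      by (rule faithful[of _ "R (fob T X)" Y])
        (use that \<phi>c[of "far T f"] homD[OF that] dom.hom_ob[OF that] in \<open>auto simp: hom_def TS\<close>)
    then show "nat_trans A A (functor_comp A S T) (id_funct A) u"
      unfolding nat_trans_def
      using is_functor_comp[OF is_functor S] is_functor_id[OF dom.category_axioms] u
      by (auto simp: hom_def)
    show "is_iso A (fob (functor_comp A S T) X) (fob (id_funct A) X) (u X)" if X: "X \<in> Ob A" for X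
    proof -
      have "v X \<cdot>\<^bsub>A\<^esub> u X = ide A (R (fob T X))"
        by (rule faithful[of _ "R (fob T X)" "R (fob T X)"]) (use X \<psi>\<phi> in \<open>auto simp: hom_def\<close>)
      moreover have "u X \<cdot>\<^bsub>A\<^esub> v X = ide A X"
        by (rule faithful[of _ X X]) (use X \<phi>\<psi> in \<open>auto simp: hom_def\<close>)
      ultimately show ?thesis
        unfolding is_iso_def using X u(1)[OF X] v(1)[OF X] by auto
    qed
  qed
  show ?thesis
    unfolding is_equivalence_def using is_functor S unit counit by blast
qed

end

section \<open>Objects with structure and retracts\<close>

lemma tagged_cat_simps [simp]:
  "Ob (tagged_cat A S H i) = S"
  "(X, f, Y) \<in> Arr (tagged_cat A S H i) \<longleftrightarrow> X \<in> S \<and> Y \<in> S \<and> f \<in> H X Y"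
  "src (tagged_cat A S H i) (X, f, Y) = X"
  "tgt (tagged_cat A S H i) (X, f, Y) = Y"
  "ide (tagged_cat A S H i) X = (X, i X, X)"
  "(Y', g, Z) \<cdot>\<^bsub>tagged_cat A S H i\<^esub> (X, f, Y) = (X, g \<cdot>\<^bsub>A\<^esub> f, Z)"
  by (simp_all add: tagged_cat_def)

lemma tagged_cat_hom:
  "x \<in> hom (tagged_cat A S H i) X Y \<longleftrightarrow> X \<in> S \<and> Y \<in> S \<and> (\<exists>f\<in>H X Y. x = (X, f, Y))"
  by (cases x) (auto simp: hom_def)

text \<open>Associativity is inherited from \<open>A\<close>, with \<open>u\<close> giving the
  underlying object. The unit laws are a hypothesis because \<open>i X\<close> may differ from the
  identity of \<open>A\<close>, as it does in the idempotent completion.\<close>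

lemma category_tagged_cat:
  assumes "category A"
    and H: "\<And>X Y f. X \<in> S \<Longrightarrow> Y \<in> S \<Longrightarrow> f \<in> H X Y \<Longrightarrow> f \<in> hom A (u X) (u Y)"
    and i: "\<And>X. X \<in> S \<Longrightarrow> i X \<in> H X X"
    and cmp: "\<And>X Y Z f g. X \<in> S \<Longrightarrow> Y \<in> S \<Longrightarrow> Z \<in> S \<Longrightarrow> f \<in> H X Y \<Longrightarrow> g \<in> H Y Z
      \<Longrightarrow> g \<cdot>\<^bsub>A\<^esub> f \<in> H X Z"
    and neutral: "\<And>X Y f. X \<in> S \<Longrightarrow> Y \<in> S \<Longrightarrow> f \<in> H X Y \<Longrightarrow> f \<cdot>\<^bsub>A\<^esub> i X = f \<and> i Y \<cdot>\<^bsub>A\<^esub> f = f"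
  shows "category (tagged_cat A S H i)"
proof -
  interpret category A by fact
  show ?thesis
  proof
    fix f assume "f \<in> Arr (tagged_cat A S H i)"
    then show "src (tagged_cat A S H i) f \<in> Ob (tagged_cat A S H i)"
      and "tgt (tagged_cat A S H i) f \<in> Ob (tagged_cat A S H i)"
      by (cases f; simp)+
  next
    fix f g h W X Y Z
    assume "f \<in> hom (tagged_cat A S H i) W X" "g \<in> hom (tagged_cat A S H i) X Y"
      "h \<in> hom (tagged_cat A S H i) Y Z"
    then show "h \<cdot>\<^bsub>tagged_cat A S H i\<^esub> (g \<cdot>\<^bsub>tagged_cat A S H i\<^esub> f)
        = h \<cdot>\<^bsub>tagged_cat A S H i\<^esub> g \<cdot>\<^bsub>tagged_cat A S H i\<^esub> f"
      using H by (auto simp: tagged_cat_hom) (metis assoc)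
  qed (use i cmp neutral in \<open>auto simp: tagged_cat_hom\<close>)
qed

section \<open>The idempotent completion as a category\<close>

lemma idem_completion_Ob [simp]:
  "(X, u) \<in> Ob (idem_completion A) \<longleftrightarrow> X \<in> Ob A \<and> u \<in> hom A X X \<and> u \<cdot>\<^bsub>A\<^esub> u = u"
  by (simp add: idem_completion_def)

lemma idem_completion_simps [simp]:
  "src (idem_completion A) (X, f, Y) = X"
  "tgt (idem_completion A) (X, f, Y) = Y"
  "ide (idem_completion A) (Z, u) = ((Z, u), u, (Z, u))"
  "(Y', g, Z') \<cdot>\<^bsub>idem_completion A\<^esub> (X, f, Y) = (X, g \<cdot>\<^bsub>A\<^esub> f, Z')"
  by (simp_all add: idem_completion_def)

context category
begin

text \<open>Composing the single equation with \<open>u\<close> or with \<open>v\<close> and using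
  idempotence splits it into two absorption laws, which are easier to rewrite with and to carry
  along functors.\<close>

lemma idempotent_absorb:
  assumes "u \<in> hom A X X" "u \<cdot> u = u" "v \<in> hom A Y Y" "v \<cdot> v = v" "f \<in> hom A X Y"
  shows "f = v \<cdot> f \<cdot> u \<longleftrightarrow> f \<cdot> u = f \<and> v \<cdot> f = f"
proof
  note [simp] = homD[OF assms(1)] homD[OF assms(3)] homD[OF assms(5)]
  assume f: "f = v \<cdot> f \<cdot> u"
  have "v \<cdot> f \<cdot> u \<cdot> u = v \<cdot> f \<cdot> (u \<cdot> u)" "v \<cdot> (v \<cdot> f \<cdot> u) = v \<cdot> v \<cdot> f \<cdot> u"
    by (simp_all add: cmp_assoc)
  then show "f \<cdot> u = f \<and> v \<cdot> f = f" unfolding assms(2,4) f[symmetric] by blast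
qed auto

lemma idem_completion_Arr [simp]:
  "((X, u), f, (Y, v)) \<in> Arr (idem_completion A) \<longleftrightarrow>
    (X, u) \<in> Ob (idem_completion A) \<and> (Y, v) \<in> Ob (idem_completion A) \<and>
    f \<in> hom A X Y \<and> f \<cdot> u = f \<and> v \<cdot> f = f"
  using idempotent_absorb[of u X v Y f] by (auto simp: idem_completion_def)

lemma category_idem_completion: "category (idem_completion A)"
  unfolding idem_completion_def
proof (rule category_tagged_cat[where u = fst], rule category_axioms, goal_cases)
  case (3 X Y Z f g)
  then obtain X1 u Y1 v Z1 w where eq: "X = (X1, u)" "Y = (Y1, v)" "Z = (Z1, w)"
    by (metis prod.exhaust)
  then have *: "u \<in> hom A X1 X1" "u \<cdot> u = u" "v \<in> hom A Y1 Y1" "v \<cdot> v = v"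
    "w \<in> hom A Z1 Z1" "w \<cdot> w = w" and fg: "f \<in> hom A X1 Y1" "g \<in> hom A Y1 Z1"
    using 3 by auto
  have gf: "g \<cdot> f \<in> hom A X1 Z1" using fg by (rule cmp_in)
  have "f \<cdot> u = f" "w \<cdot> g = g"
    using 3 eq idempotent_absorb[OF *(1-4) fg(1)] idempotent_absorb[OF *(3-6) fg(2)] by auto
  then have "g \<cdot> f \<cdot> u = g \<cdot> f" "w \<cdot> (g \<cdot> f) = g \<cdot> f"
    using assoc[OF *(1) fg] assoc[OF fg *(5)] by simp_all
  then show ?case using gf idempotent_absorb[OF *(1,2,5,6) gf] eq by simp
next
  case (4 X Y f)
  then show ?case using idempotent_absorb[of "snd X" "fst X" "snd Y" "fst Y" f] by auto
qed auto

end

section \<open>From retracts to equivalences\<close>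

locale full_and_surjective_up_to_retracts = fully_faithful +
  assumes retract: "Z \<in> Ob B \<Longrightarrow>
    \<exists>X\<in>Ob A. \<exists>p\<in>hom B (fob T X) Z. \<exists>s\<in>hom B Z (fob T X). p \<cdot>\<^bsub>B\<^esub> s = ide B Z"
begin

lemma equivalence_if_idempotent_complete:
  assumes "idempotent_complete A"
  shows "is_equivalence A B T"
proof (rule equivalence_if_essentially_surjective)
  fix Z assume Z: "Z \<in> Ob B"
  obtain X p s where X [simp]: "X \<in> Ob A" and p: "p \<in> hom B (fob T X) Z"
    and s: "s \<in> hom B Z (fob T X)" and ps: "p \<cdot>\<^bsub>B\<^esub> s = ide B Z"
    using retract[OF Z] by blast
  obtain h where h: "h \<in> hom A X X" and Th: "far T h = s \<cdot>\<^bsub>B\<^esub> p"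
    using full[OF X X cod.cmp_in[OF p s]] by blast
  note [simp] = homD[OF p] homD[OF s] homD[OF h]
  have "far T (h \<cdot>\<^bsub>A\<^esub> h) = s \<cdot>\<^bsub>B\<^esub> (p \<cdot>\<^bsub>B\<^esub> s) \<cdot>\<^bsub>B\<^esub> p"
    by (simp add: Th cod.cmp_assoc)
  then have "far T (h \<cdot>\<^bsub>A\<^esub> h) = far T h" by (simp add: ps Th)
  then have "h \<cdot>\<^bsub>A\<^esub> h = h" using faithful[OF dom.cmp_in[OF h h] h] by simp
  then obtain Y q i where Y: "Y \<in> Ob A" and q: "q \<in> hom A X Y" and i: "i \<in> hom A Y X"
    and iq: "i \<cdot>\<^bsub>A\<^esub> q = h" and qi: "q \<cdot>\<^bsub>A\<^esub> i = ide A Y"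
    using assms X h unfolding idempotent_complete_def by blast
  note [simp] = homD[OF q] homD[OF i]
  have Ti_Tq: "far T i \<cdot>\<^bsub>B\<^esub> far T q = s \<cdot>\<^bsub>B\<^esub> p"
    using Th iq by (metis far_cmp homD i q)
  have Tq_Ti: "far T q \<cdot>\<^bsub>B\<^esub> far T i = ide B (fob T Y)"
    using qi Y by (metis far_cmp far_ide homD i q)
  \<comment> \<open>Exchanging the two factorizations of the common idempotent turns each composite
    of the comparison maps into a product of two identities.\<close>
  have "far T q \<cdot>\<^bsub>B\<^esub> s \<cdot>\<^bsub>B\<^esub> (p \<cdot>\<^bsub>B\<^esub> far T i) = far T q \<cdot>\<^bsub>B\<^esub> (s \<cdot>\<^bsub>B\<^esub> p) \<cdot>\<^bsub>B\<^esub> far T i"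
    by (simp add: cod.cmp_assoc)
  also have "\<dots> = (far T q \<cdot>\<^bsub>B\<^esub> far T i) \<cdot>\<^bsub>B\<^esub> (far T q \<cdot>\<^bsub>B\<^esub> far T i)"
    unfolding Ti_Tq[symmetric] by (simp add: cod.cmp_assoc)
  finally have 1: "far T q \<cdot>\<^bsub>B\<^esub> s \<cdot>\<^bsub>B\<^esub> (p \<cdot>\<^bsub>B\<^esub> far T i) = ide B (fob T Y)"
    using Y by (simp add: Tq_Ti)
  have "p \<cdot>\<^bsub>B\<^esub> far T i \<cdot>\<^bsub>B\<^esub> (far T q \<cdot>\<^bsub>B\<^esub> s) = p \<cdot>\<^bsub>B\<^esub> (far T i \<cdot>\<^bsub>B\<^esub> far T q) \<cdot>\<^bsub>B\<^esub> s"
    by (simp add: cod.cmp_assoc)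
  also have "\<dots> = (p \<cdot>\<^bsub>B\<^esub> s) \<cdot>\<^bsub>B\<^esub> (p \<cdot>\<^bsub>B\<^esub> s)"
    unfolding Ti_Tq by (simp add: cod.cmp_assoc)
  finally have 2: "p \<cdot>\<^bsub>B\<^esub> far T i \<cdot>\<^bsub>B\<^esub> (far T q \<cdot>\<^bsub>B\<^esub> s) = ide B Z"
    using Z by (simp add: ps)
  have "is_iso B (fob T Y) Z (p \<cdot>\<^bsub>B\<^esub> far T i)"
    unfolding is_iso_def using 1 2 by (intro conjI bexI[of _ "far T q \<cdot>\<^bsub>B\<^esub> s"]) (auto simp: hom_def)
  then show "\<exists>X\<in>Ob A. \<exists>f. is_iso B (fob T X) Z f" using Y by blast
qed

lemma idem_completion_functor_simps [simp]:
  "(X, u) \<in> Ob (idem_completion A) \<Longrightarrow>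
    fob (idem_completion_functor A T) (X, u) = (fob T X, far T u)"
  "((X, u), f, (Y, v)) \<in> Arr (idem_completion A) \<Longrightarrow>
    far (idem_completion_functor A T) ((X, u), f, (Y, v)) = ((fob T X, far T u), far T f, (fob T Y, far T v))"
  by (simp_all add: idem_completion_functor_def del: dom.idem_completion_Arr)

lemma is_functor_idem_completion:
  "is_functor (idem_completion A) (idem_completion B) (idem_completion_functor A T)"
proof (rule is_functorI, goal_cases)
  case (3 M)
  then show ?case by (cases M) (auto simp: far_hom simp flip: far_cmp dest: homD)
next
  case (5 x)
  obtain X u f Y v where x: "x = ((X, u), f, (Y, v))" by (metis prod.exhaust)
  with 5 show ?case
    by (auto simp: far_hom hom_def simp flip: far_cmp)
next
  case (7 M)
  then show ?case by (cases M) (auto simp: far_hom simp flip: far_cmp dest: homD)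
next
  case (8 x y)
  obtain X u f Y v where x: "x = ((X, u), f, (Y, v))" by (metis prod.exhaust)
  obtain X' u' g Y' v' where y: "y = ((X', u'), g, (Y', v'))" by (metis prod.exhaust)
  have "((X, u), g \<cdot>\<^bsub>A\<^esub> f, (Y', v')) \<in> Arr (idem_completion A)"
    using category.arr_cmp(1)[OF dom.category_idem_completion 8] x y by simp
  then show ?case using 8 by (auto simp: x y hom_def)
qed (auto simp: idem_completion_functor_def dom.category_idem_completion cod.category_idem_completion)

text \<open>Full faithfulness passes to the completions. For essential surjectivity at
  \<open>(Z, w)\<close>, with \<open>Z\<close> a retract of \<open>fob T X\<close> through
  \<open>p\<close> and \<open>s\<close>, the idempotent \<open>s w p\<close> lifts to some
  \<open>h\<close> on \<open>X\<close>, and \<open>w p\<close> and \<open>s w\<close> identify the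
  image of \<open>(X, h)\<close> with \<open>(Z, w)\<close>.\<close>

theorem equivalence_up_to_retracts: "equivalence_up_to_retracts A B T"
proof -
  let ?A = "idem_completion A" and ?B = "idem_completion B" and ?T = "idem_completion_functor A T"
  interpret I: functor_between ?A ?B ?T
    by (rule functor_betweenI) (rule is_functor_idem_completion)
  interpret I: fully_faithful ?A ?B ?T
  proof
    fix M N g assume M: "M \<in> Ob ?A" and N: "N \<in> Ob ?A" and g: "g \<in> hom ?B (fob ?T M) (fob ?T N)"
    obtain X u Y v where eq [simp]: "M = (X, u)" "N = (Y, v)" by fastforce
    obtain g' where g' [simp]: "g = ((fob T X, far T u), g', (fob T Y, far T v))"
      using g M N by (cases g) (auto simp: hom_def)
    have u: "X \<in> Ob A" "Y \<in> Ob A" "u \<in> hom A X X" "v \<in> hom A Y Y" using M N by auto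
    have g'_props: "g' \<in> hom B (fob T X) (fob T Y)" "g' \<cdot>\<^bsub>B\<^esub> far T u = g'" "far T v \<cdot>\<^bsub>B\<^esub> g' = g'"
      using g by (auto simp: hom_def)
    obtain f where f: "f \<in> hom A X Y" "far T f = g'" using full[OF u(1,2) g'_props(1)] by blast
    \<comment> \<open>The absorption laws hold for \<open>g'\<close>, the image of \<open>f\<close>,
      and faithfulness reflects them.\<close>
    have "f \<cdot>\<^bsub>A\<^esub> u = f" "v \<cdot>\<^bsub>A\<^esub> f = f"
      using faithful[OF dom.cmp_in[OF u(3) f(1)] f(1)] faithful[OF dom.cmp_in[OF f(1) u(4)] f(1)]
        g'_props f(2) homD[OF f(1)] homD[OF u(3)] homD[OF u(4)] by simp_all
    then show "\<exists>x\<in>hom ?A M N. far ?T x = g"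
      using M N f by (intro bexI[of _ "((X, u), f, (Y, v))"]) (auto simp: hom_def)
  next
    fix M N x y assume xy: "x \<in> hom ?A M N" "y \<in> hom ?A M N" and T: "far ?T x = far ?T y"
    obtain X u Y v where eq [simp]: "M = (X, u)" "N = (Y, v)" by fastforce
    obtain f g where fg: "x = (M, f, N)" "y = (M, g, N)" using xy by (cases x, cases y) (auto simp: hom_def)
    have x: "((X, u), f, (Y, v)) \<in> Arr ?A" "((X, u), g, (Y, v)) \<in> Arr ?A"
      using xy fg by (auto simp: hom_def)
    then have "far T f = far T g" using T fg by (simp del: dom.idem_completion_Arr)
    moreover have "f \<in> hom A X Y" "g \<in> hom A X Y" using x by auto
    ultimately show "x = y" using faithful fg by blast
  qed
  have "is_equivalence ?A ?B ?T"
  proof (rule I.equivalence_if_essentially_surjective)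
    fix M assume M: "M \<in> Ob ?B"
    obtain Z w where M_eq: "M = (Z, w)" by fastforce
    have Z: "Z \<in> Ob B" and w: "w \<in> hom B Z Z" and ww: "w \<cdot>\<^bsub>B\<^esub> w = w" using M M_eq by auto
    obtain X p s where X [simp]: "X \<in> Ob A" and p: "p \<in> hom B (fob T X) Z"
      and s: "s \<in> hom B Z (fob T X)" and ps: "p \<cdot>\<^bsub>B\<^esub> s = ide B Z"
      using retract[OF Z] by blast
    note [simp] = homD[OF p] homD[OF s] homD[OF w]
    have wps: "w \<cdot>\<^bsub>B\<^esub> p \<cdot>\<^bsub>B\<^esub> s = w"
      using cod.cmp_assoc[of s p w] ps by simp
    obtain h where h: "h \<in> hom A X X" and Th: "far T h = s \<cdot>\<^bsub>B\<^esub> w \<cdot>\<^bsub>B\<^esub> p"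
      using full[OF X X cod.cmp_in[OF p cod.cmp_in[OF w s]]] by blast
    note [simp] = homD[OF h]
    \<comment> \<open>Absorption laws that make \<open>w p\<close> and \<open>s w\<close> arrows of
      the completion, together with their two composites.\<close>
    have eqs: "s \<cdot>\<^bsub>B\<^esub> w \<cdot>\<^bsub>B\<^esub> p \<cdot>\<^bsub>B\<^esub> (s \<cdot>\<^bsub>B\<^esub> w) = s \<cdot>\<^bsub>B\<^esub> w"
        "w \<cdot>\<^bsub>B\<^esub> p \<cdot>\<^bsub>B\<^esub> (s \<cdot>\<^bsub>B\<^esub> w \<cdot>\<^bsub>B\<^esub> p) = w \<cdot>\<^bsub>B\<^esub> p"
        "s \<cdot>\<^bsub>B\<^esub> w \<cdot>\<^bsub>B\<^esub> (w \<cdot>\<^bsub>B\<^esub> p) = s \<cdot>\<^bsub>B\<^esub> w \<cdot>\<^bsub>B\<^esub> p"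
        "w \<cdot>\<^bsub>B\<^esub> p \<cdot>\<^bsub>B\<^esub> (s \<cdot>\<^bsub>B\<^esub> w) = w"
        "w \<cdot>\<^bsub>B\<^esub> (w \<cdot>\<^bsub>B\<^esub> p) = w \<cdot>\<^bsub>B\<^esub> p"
        "s \<cdot>\<^bsub>B\<^esub> w \<cdot>\<^bsub>B\<^esub> w = s \<cdot>\<^bsub>B\<^esub> w"
    proof -
      show sww: "s \<cdot>\<^bsub>B\<^esub> w \<cdot>\<^bsub>B\<^esub> w = s \<cdot>\<^bsub>B\<^esub> w" using cod.cmp_assoc[of w w s] ww by simp
      have swps: "s \<cdot>\<^bsub>B\<^esub> w \<cdot>\<^bsub>B\<^esub> p \<cdot>\<^bsub>B\<^esub> s = s \<cdot>\<^bsub>B\<^esub> w"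
        using ps cod.cmp_assoc[of s p "s \<cdot>\<^bsub>B\<^esub> w"] by (simp add: cod.cmp_assoc)
      show "s \<cdot>\<^bsub>B\<^esub> w \<cdot>\<^bsub>B\<^esub> p \<cdot>\<^bsub>B\<^esub> (s \<cdot>\<^bsub>B\<^esub> w) = s \<cdot>\<^bsub>B\<^esub> w"
        using swps sww by (simp add: cod.cmp_assoc)
      show "w \<cdot>\<^bsub>B\<^esub> p \<cdot>\<^bsub>B\<^esub> (s \<cdot>\<^bsub>B\<^esub> w \<cdot>\<^bsub>B\<^esub> p) = w \<cdot>\<^bsub>B\<^esub> p"
        "s \<cdot>\<^bsub>B\<^esub> w \<cdot>\<^bsub>B\<^esub> (w \<cdot>\<^bsub>B\<^esub> p) = s \<cdot>\<^bsub>B\<^esub> w \<cdot>\<^bsub>B\<^esub> p"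
        "w \<cdot>\<^bsub>B\<^esub> p \<cdot>\<^bsub>B\<^esub> (s \<cdot>\<^bsub>B\<^esub> w) = w" "w \<cdot>\<^bsub>B\<^esub> (w \<cdot>\<^bsub>B\<^esub> p) = w \<cdot>\<^bsub>B\<^esub> p"
        using ww wps sww by (simp_all add: cod.cmp_assoc)
    qed
    have "far T (h \<cdot>\<^bsub>A\<^esub> h) = far T h"
      using eqs(1) by (simp add: Th cod.cmp_assoc)
    then have "h \<cdot>\<^bsub>A\<^esub> h = h" using faithful[OF dom.cmp_in[OF h h] h] by simp
    then have N: "(X, h) \<in> Ob ?A" using h by simp
    have M': "(fob T X, s \<cdot>\<^bsub>B\<^esub> w \<cdot>\<^bsub>B\<^esub> p) \<in> Ob ?B" using I.fob_in[OF N] N by (simp add: Th)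
    let ?f = "(fob ?T (X, h), w \<cdot>\<^bsub>B\<^esub> p, M)" and ?g = "(M, s \<cdot>\<^bsub>B\<^esub> w, fob ?T (X, h))"
    have "?f \<in> hom ?B (fob ?T (X, h)) M" "?g \<in> hom ?B M (fob ?T (X, h))"
      using M M' N eqs by (simp_all add: M_eq Th hom_def)
    \<comment> \<open>Identities of the completion are the idempotents themselves, so the composites
      only have to equal \<open>far T h\<close> and \<open>w\<close>.\<close>
    moreover have "?g \<cdot>\<^bsub>?B\<^esub> ?f = ide ?B (fob ?T (X, h))" "?f \<cdot>\<^bsub>?B\<^esub> ?g = ide ?B M"
      using N eqs by (simp_all add: M_eq Th)
    ultimately have "is_iso ?B (fob ?T (X, h)) M ?f" unfolding is_iso_def by blast
    with N show "\<exists>N\<in>Ob ?A. \<exists>f. is_iso ?B (fob ?T N) M f" by blast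
  qed
  then show ?thesis by (simp add: equivalence_up_to_retracts_def is_functor)
qed

end

section \<open>The coidentifier of a natural idempotent\<close>

locale natural_idempotent = category A for A :: "('o, 'm) cat" (structure) +
  fixes e :: "'o \<Rightarrow> 'm"
  assumes e_hom: "X \<in> Ob A \<Longrightarrow> e X \<in> hom A X X"
    and e_natural: "f \<in> Arr A \<Longrightarrow> e (tgt A f) \<cdot> f = f \<cdot> e (src A f)"
    and e_idem: "X \<in> Ob A \<Longrightarrow> e X \<cdot> e X = e X"
begin

abbreviation cls where "cls f \<equiv> coid_rel A e `` {f}"
abbreviation Ae where "Ae \<equiv> coidentifier A e"
abbreviation H where "H \<equiv> quotient_functor A e"

lemma e_arr [simp]: "X \<in> Ob A \<Longrightarrow> e X \<in> Arr A"
  "X \<in> Ob A \<Longrightarrow> src A (e X) = X" "X \<in> Ob A \<Longrightarrow> tgt A (e X) = X"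
  using e_hom by (auto simp: hom_def)

lemma coid_rel_iff:
  "(f, g) \<in> coid_rel A e \<longleftrightarrow> f \<in> Arr A \<and> g \<in> Arr A \<and> src A f = src A g \<and> tgt A f = tgt A g \<and>
    e (tgt A f) \<cdot> f = e (tgt A f) \<cdot> g"
  by (simp add: coid_rel_def)

lemma equiv_coid_rel: "equiv (Arr A) (coid_rel A e)"
  by (rule equivI) (auto simp: coid_rel_iff refl_on_def sym_def trans_def)

lemma cls_eq_iff:
  assumes "f \<in> Arr A" "g \<in> Arr A"
  shows "cls f = cls g \<longleftrightarrow>
    src A f = src A g \<and> tgt A f = tgt A g \<and> e (tgt A f) \<cdot> f = e (tgt A f) \<cdot> g"
  using assms by (simp add: eq_equiv_class_iff[OF equiv_coid_rel assms] coid_rel_iff)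

lemma in_cls_iff: "f \<in> Arr A \<Longrightarrow> g \<in> cls f \<longleftrightarrow> g \<in> Arr A \<and> cls g = cls f"
  by (metis Image_singleton_iff coid_rel_iff eq_equiv_class_iff equiv_coid_rel)

lemma cls_self: "f \<in> Arr A \<Longrightarrow> f \<in> cls f"
  by (simp add: coid_rel_iff)

text \<open>A function constant on a class has a singleton image. This evaluates \<open>src\<close>
  and \<open>tgt\<close> of the coidentifier, and later the arrow map of a factored functor.\<close>

lemma the_elem_cls:
  assumes "f \<in> Arr A" and "\<And>g. g \<in> Arr A \<Longrightarrow> cls g = cls f \<Longrightarrow> h g = h f"
  shows "the_elem (h ` cls f) = h f"
proof -
  have "h g = h f" if "g \<in> cls f" for g
    using assms(2) in_cls_iff[OF assms(1)] that by blast
  then have "h ` cls f = {h f}"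
    using cls_self[OF assms(1)] by blast
  then show ?thesis by simp
qed

text \<open>Well-definedness of composition: naturality moves \<open>e\<close> past
  \<open>g\<close>, so that it reaches \<open>f'\<close> and allows its replacement by
  \<open>f\<close>.\<close>

lemma cls_cmp:
  assumes "f \<in> Arr A" "g \<in> Arr A" "f' \<in> Arr A" "g' \<in> Arr A" "tgt A f = src A g"
    and "cls f' = cls f" "cls g' = cls g"
  shows "cls (g' \<cdot> f') = cls (g \<cdot> f)"
proof -
  have *: "src A f' = src A f" "tgt A f' = src A g" "src A g' = src A g" "tgt A g' = tgt A g"
    "e (src A g) \<cdot> f' = e (src A g) \<cdot> f" "e (tgt A g) \<cdot> g' = e (tgt A g) \<cdot> g"
    using assms by (auto simp: cls_eq_iff)
  note [simp] = assms(1-5) *(1-4)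
  have "e (tgt A g) \<cdot> (g' \<cdot> f') = e (tgt A g) \<cdot> g \<cdot> f'"
    by (simp add: cmp_assoc *)
  also have "\<dots> = g \<cdot> (e (src A g) \<cdot> f')"
    by (simp add: cmp_assoc e_natural)
  also have "\<dots> = e (tgt A g) \<cdot> (g \<cdot> f)"
    unfolding * by (simp add: cmp_assoc e_natural)
  finally show ?thesis by (subst cls_eq_iff) auto
qed

lemma coidentifier_simps [simp]:
  "Ob Ae = Ob A"
  "Arr Ae = cls ` Arr A"
  "f \<in> Arr A \<Longrightarrow> src Ae (cls f) = src A f"
  "f \<in> Arr A \<Longrightarrow> tgt Ae (cls f) = tgt A f"
  "ide Ae X = cls (ide A X)"
  "f \<in> Arr A \<Longrightarrow> g \<in> Arr A \<Longrightarrow> tgt A f = src A g \<Longrightarrow> cls g \<cdot>\<^bsub>Ae\<^esub> cls f = cls (g \<cdot> f)"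
proof -
  assume fg: "f \<in> Arr A" "g \<in> Arr A" "tgt A f = src A g"
  have "cls g \<cdot>\<^bsub>Ae\<^esub> cls f = (\<Union>g'\<in>cls g. \<Union>f'\<in>cls f. cls (g' \<cdot> f'))"
    by (simp add: coidentifier_def)
  \<comment> \<open>All members of the union coincide by \<open>cls_cmp\<close>, and the index sets
    contain \<open>g\<close> and \<open>f\<close>.\<close>
  also have "\<dots> = (\<Union>g'\<in>cls g. \<Union>f'\<in>cls f. cls (g \<cdot> f))"
  proof (intro SUP_cong refl)
    fix f' g' assume "g' \<in> cls g" "f' \<in> cls f"
    then show "cls (g' \<cdot> f') = cls (g \<cdot> f)"
      unfolding in_cls_iff[OF fg(1)] in_cls_iff[OF fg(2)] using cls_cmp fg by blast
  qed
  also have "\<dots> = cls (g \<cdot> f)" using cls_self fg(1,2) by blast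
  finally show "cls g \<cdot>\<^bsub>Ae\<^esub> cls f = cls (g \<cdot> f)" .
next
  assume f: "f \<in> Arr A"
  have "the_elem (src A ` cls f) = src A f" "the_elem (tgt A ` cls f) = tgt A f"
    by (rule the_elem_cls[OF f], use cls_eq_iff[OF _ f] in blast)+
  then show "src Ae (cls f) = src A f" "tgt Ae (cls f) = tgt A f"
    by (simp_all add: coidentifier_def)
next
  show "Arr Ae = cls ` Arr A" by (auto simp only: coidentifier_def quotient_def cat.simps)
qed (simp_all add: coidentifier_def)

lemma cls_hom: "f \<in> hom A X Y \<Longrightarrow> cls f \<in> hom Ae X Y"
  by (auto simp: hom_def)

lemma hom_coidentifier: "hom Ae X Y = cls ` hom A X Y"
  by (auto simp: hom_def)

lemma category_coidentifier: "category Ae"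
proof
  fix f assume "f \<in> Arr Ae"
  then show "src Ae f \<in> Ob Ae" "tgt Ae f \<in> Ob Ae" by auto
next
  fix X assume "X \<in> Ob Ae"
  then show "ide Ae X \<in> hom Ae X X" using cls_hom[OF ide_in] by simp
next
  fix p q X Y Z assume "p \<in> hom Ae X Y" "q \<in> hom Ae Y Z"
  then obtain f g where "p = cls f" "q = cls g" and fg: "f \<in> hom A X Y" "g \<in> hom A Y Z"
    by (auto simp: hom_coidentifier)
  then show "q \<cdot>\<^bsub>Ae\<^esub> p \<in> hom Ae X Z"
    using cls_hom[OF cmp_in[OF fg]] homD[OF fg(1)] homD[OF fg(2)] by simp
next
  fix p X Y assume "p \<in> hom Ae X Y"
  then obtain f where "p = cls f" "f \<in> hom A X Y" by (auto simp: hom_coidentifier)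
  then show "p \<cdot>\<^bsub>Ae\<^esub> ide Ae X = p" "ide Ae Y \<cdot>\<^bsub>Ae\<^esub> p = p"
    using hom_ob by (auto dest!: homD)
next
  fix p q r W X Y Z assume "p \<in> hom Ae W X" "q \<in> hom Ae X Y" "r \<in> hom Ae Y Z"
  then obtain f g h where "p = cls f" "q = cls g" "r = cls h"
    "f \<in> hom A W X" "g \<in> hom A X Y" "h \<in> hom A Y Z" by (auto simp: hom_coidentifier)
  then show "r \<cdot>\<^bsub>Ae\<^esub> (q \<cdot>\<^bsub>Ae\<^esub> p) = r \<cdot>\<^bsub>Ae\<^esub> q \<cdot>\<^bsub>Ae\<^esub> p"
    by (auto dest!: homD simp: cmp_assoc)
qed

lemma quotient_functor_simps [simp]:
  "X \<in> Ob A \<Longrightarrow> fob H X = X" "f \<in> Arr A \<Longrightarrow> far H f = cls f"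
  by (simp_all add: quotient_functor_def)

lemma is_functor_quotient: "is_functor A Ae H"
  by (rule is_functorI)
    (auto simp: category_axioms category_coidentifier cls_hom hom_def, auto simp: quotient_functor_def)

text \<open>If the class of \<open>f\<close> is idempotent, then
  \<open>e X \<cdot> f \<cdot> f = e X \<cdot> f\<close>. As \<open>e\<close> is natural and
  idempotent, \<open>e X \<cdot> f\<close> is a genuine idempotent in the same class, and the
  classes of a splitting of it split the given one.\<close>

lemma idempotent_complete_coidentifier:
  assumes "idempotent_complete A"
  shows "idempotent_complete Ae"
  unfolding idempotent_complete_def
proof (intro ballI impI)
  fix X c assume X: "X \<in> Ob Ae" and c: "c \<in> hom Ae X X" and cc: "c \<cdot>\<^bsub>Ae\<^esub> c = c"
  then obtain f where f: "f \<in> hom A X X" and c_eq: "c = cls f" by (auto simp: hom_coidentifier)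
  note [simp] = homD[OF f]
  have X': "X \<in> Ob A" using X by simp
  note [simp] = this
  have eff: "e X \<cdot> f \<cdot> f = e X \<cdot> f"
    using cc c_eq by (simp add: cls_eq_iff cmp_assoc)
  have nat: "f \<cdot> e X = e X \<cdot> f" using e_natural[of f] by simp
  have "e X \<cdot> f \<cdot> (e X \<cdot> f) = e X \<cdot> (f \<cdot> e X) \<cdot> f" by (simp add: cmp_assoc)
  also have "\<dots> = e X \<cdot> e X \<cdot> f \<cdot> f" unfolding nat by (simp add: cmp_assoc)
  finally have "e X \<cdot> f \<cdot> (e X \<cdot> f) = e X \<cdot> f" by (simp add: e_idem eff)
  moreover have "e X \<cdot> f \<in> hom A X X" by (simp add: hom_def)
  ultimately obtain Y p i where Y: "Y \<in> Ob A" and p: "p \<in> hom A X Y" and i: "i \<in> hom A Y X"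
    and ip: "i \<cdot> p = e X \<cdot> f" and pi: "p \<cdot> i = ide A Y"
    using assms X' unfolding idempotent_complete_def by blast
  note [simp] = homD[OF p] homD[OF i]
  have "cls (e X \<cdot> f) = c" unfolding c_eq by (subst cls_eq_iff) (auto simp: cmp_assoc e_idem)
  then have "cls i \<cdot>\<^bsub>Ae\<^esub> cls p = c" by (simp add: ip)
  moreover have "cls p \<cdot>\<^bsub>Ae\<^esub> cls i = ide Ae Y" by (simp add: pi)
  ultimately show "\<exists>Y\<in>Ob Ae. \<exists>p\<in>hom Ae X Y. \<exists>i\<in>hom Ae Y X.
      i \<cdot>\<^bsub>Ae\<^esub> p = c \<and> p \<cdot>\<^bsub>Ae\<^esub> i = ide Ae Y"
    using Y cls_hom[OF p] cls_hom[OF i] unfolding coidentifier_simps(1) by blast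
qed

section \<open>Factoring functors through the coidentifier\<close>

lemma factor_far:
  assumes "functor_comp A K H = L" "f \<in> Arr A"
  shows "far K (cls f) = far L f"
  using functor_comp_simps(2)[OF assms(2), of K H] assms by simp

lemma factor_fob:
  assumes "functor_comp A K H = L" "X \<in> Ob A"
  shows "fob K X = fob L X"
  using functor_comp_simps(1)[OF assms(2), of K H] assms by simp

text \<open>The quotient functor is surjective on objects and on arrows.\<close>

lemma factor_unique:
  assumes "is_functor Ae E K" "is_functor Ae E K'"
    and "functor_comp A K H = L" "functor_comp A K' H = L"
  shows "K = K'"
  using assms(1,2) by (rule funct_eqI) (auto simp: factor_far[OF assms(3)] factor_far[OF assms(4)]
      factor_fob[OF assms(3)] factor_fob[OF assms(4)])

text \<open>The factor evaluates \<open>L\<close> on a representative; the hypothesis on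
  \<open>L\<close> makes the value independent of the choice.\<close>

lemma factor_exists:
  assumes "is_functor A E L"
    and L: "\<And>X Y f g. f \<in> hom A X Y \<Longrightarrow> g \<in> hom A X Y \<Longrightarrow> e Y \<cdot> f = e Y \<cdot> g \<Longrightarrow> far L f = far L g"
  shows "\<exists>K. is_functor Ae E K \<and> functor_comp A K H = L"
proof -
  interpret L: functor_between A E L by (rule functor_betweenI) fact
  define K where "K = \<lparr>fob = fob L, far = (\<lambda>p\<in>Arr Ae. the_elem (far L ` p))\<rparr>"
  have cls: "far K (cls f) = far L f" if f: "f \<in> Arr A" for f
  proof -
    have "the_elem (far L ` cls f) = far L f"
    proof (rule the_elem_cls[OF f])
      fix g assume "g \<in> Arr A" "cls g = cls f"
      then show "far L g = far L f"
        using f L[of g "src A f" "tgt A f" f] by (auto simp: cls_eq_iff hom_def)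
    qed
    then show ?thesis using f by (auto simp: K_def)
  qed
  have fob: "fob K = fob L" by (simp add: K_def)
  have K: "is_functor Ae E K"
    by (rule is_functorI)
      (auto simp: cls fob category_coidentifier L.cod.category_axioms L.far_hom L.fob_undefined hom_def,
       auto simp: K_def)
  moreover have "functor_comp A K H = L"
    by (rule funct_eqI[OF is_functor_comp[OF is_functor_quotient K] assms(1)]) (auto simp: cls fob)
  ultimately show ?thesis by blast
qed

text \<open>Fullness passes from \<open>L\<close> to its factor, and faithfulness holds because
  \<open>L\<close> identifies only arrows that lie in one class.\<close>

lemma fully_faithful_factor:
  assumes "is_functor A E L" and K: "is_functor Ae E K" "functor_comp A K H = L"
    and full: "\<And>X Y g. X \<in> Ob A \<Longrightarrow> Y \<in> Ob A \<Longrightarrow> g \<in> hom E (fob L X) (fob L Y)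
      \<Longrightarrow> \<exists>f\<in>hom A X Y. far L f = g"
    and L: "\<And>X Y f g. f \<in> hom A X Y \<Longrightarrow> g \<in> hom A X Y \<Longrightarrow> far L f = far L g
      \<Longrightarrow> e Y \<cdot> f = e Y \<cdot> g"
  shows "fully_faithful Ae E K"
proof -
  interpret K: functor_between Ae E K by (rule functor_betweenI) fact
  show ?thesis
  proof
    fix X Y g assume "X \<in> Ob Ae" "Y \<in> Ob Ae" "g \<in> hom E (fob K X) (fob K Y)"
    then obtain f where "f \<in> hom A X Y" "far L f = g"
      using full[of X Y g] by (auto simp: factor_fob[OF K(2)])
    then show "\<exists>p\<in>hom Ae X Y. far K p = g"
      using cls_hom factor_far[OF K(2)] homD by metis
  next
    fix X Y p q assume "p \<in> hom Ae X Y" "q \<in> hom Ae X Y" "far K p = far K q"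
    then obtain f g where fg: "p = cls f" "q = cls g" "f \<in> hom A X Y" "g \<in> hom A X Y"
      and "far L f = far L g"
      by (auto simp: hom_coidentifier factor_far[OF K(2)] dest: homD)
        (metis K(2) factor_far homD)
    with L[OF fg(3,4)] homD[OF fg(3)] homD[OF fg(4)] show "p = q" by (simp add: cls_eq_iff)
  qed
qed

end

section \<open>Semiseparable functors\<close>

text \<open>\<open>P\<close> is fixed along with the idempotent it produces, since it will be
  applied to arrows of \<open>B\<close> that are not known to be images under
  \<open>T\<close>.\<close>

locale semiseparable_functor = functor_between A B T
  for A :: "('o, 'm) cat" and B :: "('p, 'n) cat" and T :: "('o, 'm, 'p, 'n) funct" +
  fixes P :: "'o \<Rightarrow> 'o \<Rightarrow> 'n \<Rightarrow> 'm" and e :: "'o \<Rightarrow> 'm"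
  assumes semiseparating: "semiseparating A B T P"
    and e_eq: "X \<in> Ob A \<Longrightarrow> e X = P X X (ide B (fob T X))"
begin

lemma P_hom: "X \<in> Ob A \<Longrightarrow> Y \<in> Ob A \<Longrightarrow> g \<in> hom B (fob T X) (fob T Y) \<Longrightarrow> P X Y g \<in> hom A X Y"
  using semiseparating by (auto simp: semiseparating_def)

lemma P_natural:
  assumes "X \<in> Ob A" "Y \<in> Ob A" "g \<in> hom B (fob T X) (fob T Y)"
    and "h \<in> hom A X' X" "k \<in> hom A Y Y'"
  shows "P X' Y' (far T k \<cdot>\<^bsub>B\<^esub> g \<cdot>\<^bsub>B\<^esub> far T h) = k \<cdot>\<^bsub>A\<^esub> P X Y g \<cdot>\<^bsub>A\<^esub> h"
  using semiseparating assms dom.hom_ob unfolding semiseparating_def by blast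

text \<open>Naturality in the first variable alone, with an identity inserted in the second;
  \<open>P_cmp_left\<close> is the mirror image.\<close>

lemma P_cmp_right:
  assumes "Y \<in> Ob A" "g \<in> hom B (fob T X) (fob T Y)" "h \<in> hom A X' X"
  shows "P X' Y (g \<cdot>\<^bsub>B\<^esub> far T h) = P X Y g \<cdot>\<^bsub>A\<^esub> h"
proof -
  have X: "X \<in> Ob A" using dom.hom_ob[OF assms(3)] by simp
  show ?thesis
    using P_natural[OF X assms(1-3) dom.ide_in[OF assms(1)]] P_hom[OF X assms(1,2)]
      homD[OF assms(2)] assms(1) by (auto dest: homD)
qed

lemma P_cmp_left:
  assumes "X \<in> Ob A" "g \<in> hom B (fob T X) (fob T Y)" "k \<in> hom A Y Y'"
  shows "P X Y' (far T k \<cdot>\<^bsub>B\<^esub> g) = k \<cdot>\<^bsub>A\<^esub> P X Y g"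
proof -
  have Y: "Y \<in> Ob A" using dom.hom_ob[OF assms(3)] by simp
  show ?thesis
    using P_natural[OF assms(1) Y assms(2) dom.ide_in[OF assms(1)] assms(3)]
      P_hom[OF assms(1) Y assms(2)] homD[OF assms(2)] homD[OF assms(3)] assms(1)
    by (auto dest: homD)
qed

lemma far_P_far: "f \<in> hom A X Y \<Longrightarrow> far T (P X Y (far T f)) = far T f"
  using semiseparating dom.hom_ob unfolding semiseparating_def by blast

text \<open>Naturality pulls \<open>f\<close> out of \<open>P\<close> on either side of an identity.
  The two forms together say that \<open>e\<close> is natural.\<close>

lemma P_far:
  assumes "f \<in> hom A X Y"
  shows "P X Y (far T f) = e Y \<cdot>\<^bsub>A\<^esub> f" "P X Y (far T f) = f \<cdot>\<^bsub>A\<^esub> e X"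
proof -
  have ob: "X \<in> Ob A" "Y \<in> Ob A" using dom.hom_ob[OF assms] by auto
  show "P X Y (far T f) = e Y \<cdot>\<^bsub>A\<^esub> f"
    using P_cmp_right[OF ob(2) _ assms, of "ide B (fob T Y)"] ob homD[OF assms]
    by (simp add: e_eq hom_def)
  show "P X Y (far T f) = f \<cdot>\<^bsub>A\<^esub> e X"
    using P_cmp_left[OF ob(1) _ assms, of "ide B (fob T X)"] ob homD[OF assms]
    by (simp add: e_eq hom_def)
qed

lemma e_hom: "X \<in> Ob A \<Longrightarrow> e X \<in> hom A X X"
  by (simp add: e_eq P_hom cod.ide_in)

text \<open>The law that \<open>T\<close> after \<open>P\<close> after \<open>T\<close> is
  \<open>T\<close>, at an identity arrow.\<close>

lemma far_e: "X \<in> Ob A \<Longrightarrow> far T (e X) = ide B (fob T X)"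
  using far_P_far[OF dom.ide_in, of X] by (simp add: e_eq)

sublocale e: natural_idempotent A e
proof
  fix X assume X: "X \<in> Ob A"
  show "e X \<in> hom A X X" using X by (rule e_hom)
  \<comment> \<open>\<open>P\<close> at \<open>far T (e X)\<close> is the square of
    \<open>e X\<close> by \<open>P_far\<close>, and it is \<open>e X\<close> because
    \<open>far T (e X)\<close> is an identity.\<close>
  show "e X \<cdot>\<^bsub>A\<^esub> e X = e X"
    using P_far(1)[OF e_hom[OF X]] far_e[OF X] e_eq[OF X] by simp
next
  fix f assume "f \<in> Arr A"
  then show "e (tgt A f) \<cdot>\<^bsub>A\<^esub> f = f \<cdot>\<^bsub>A\<^esub> e (src A f)"
    using P_far[of f "src A f" "tgt A f"] by (simp add: hom_def)
qed

lemma far_eq_iff: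
  assumes "f \<in> hom A X Y" "g \<in> hom A X Y"
  shows "far T f = far T g \<longleftrightarrow> e Y \<cdot>\<^bsub>A\<^esub> f = e Y \<cdot>\<^bsub>A\<^esub> g"
proof
  assume "far T f = far T g"
  then show "e Y \<cdot>\<^bsub>A\<^esub> f = e Y \<cdot>\<^bsub>A\<^esub> g" using P_far(1)[OF assms(1)] P_far(1)[OF assms(2)] by simp
next
  assume "e Y \<cdot>\<^bsub>A\<^esub> f = e Y \<cdot>\<^bsub>A\<^esub> g"
  then have "far T (e Y \<cdot>\<^bsub>A\<^esub> f) = far T (e Y \<cdot>\<^bsub>A\<^esub> g)" by simp
  then show "far T f = far T g"
    using dom.hom_ob[OF assms(1)] homD[OF assms(1)] homD[OF assms(2)] by (simp add: far_e)
qed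

text \<open>Existence and uniqueness of the factor justify the \<open>THE\<close> in the
  definition.\<close>

lemma coid_functor:
  "is_functor e.Ae B (coid_functor A B e T) \<and> functor_comp A (coid_functor A B e T) e.H = T"
proof -
  have "\<exists>!S. is_functor e.Ae B S \<and> functor_comp A S e.H = T"
    using e.factor_exists[OF is_functor] far_eq_iff e.factor_unique by blast
  then show ?thesis unfolding coid_functor_def by (rule theI')
qed

text \<open>The common core of both halves, with \<open>L\<close> the (co)comparison functor and
  \<open>U\<close> the forgetful functor. \<open>L\<close> and \<open>T\<close> identify the same
  arrows, one direction by \<open>L_eq\<close> and the other by \<open>UL\<close>, so
  \<open>L\<close> factors faithfully through the coidentifier.\<close>

theorem lift_to_coidentifier:
  assumes L: "is_functor A E L" and U: "is_functor E B U" and UL: "functor_comp A U L = T"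
    and L_eq: "\<And>X Y f g. f \<in> hom A X Y \<Longrightarrow> g \<in> hom A X Y \<Longrightarrow> far T f = far T g \<Longrightarrow> far L f = far L g"
    and full: "\<And>X Y g. X \<in> Ob A \<Longrightarrow> Y \<in> Ob A \<Longrightarrow> g \<in> hom E (fob L X) (fob L Y)
      \<Longrightarrow> \<exists>f\<in>hom A X Y. far L f = g"
    and retract: "\<And>Z. Z \<in> Ob E \<Longrightarrow>
      \<exists>X\<in>Ob A. \<exists>p\<in>hom E (fob L X) Z. \<exists>s\<in>hom E Z (fob L X). p \<cdot>\<^bsub>E\<^esub> s = ide E Z"
  shows "(\<exists>!K. is_functor (coidentifier A e) E K \<and>
            functor_comp A K (quotient_functor A e) = L \<and>
            functor_comp (coidentifier A e) U K = coid_functor A B e T) \<and>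
         (\<forall>K. is_functor (coidentifier A e) E K \<and>
              functor_comp A K (quotient_functor A e) = L \<and>
              functor_comp (coidentifier A e) U K = coid_functor A B e T \<longrightarrow>
            equivalence_up_to_retracts (coidentifier A e) E K \<and>
            (idempotent_complete A \<longrightarrow> is_equivalence (coidentifier A e) E K))"
proof (rule conjI)
  obtain K where K: "is_functor e.Ae E K" "functor_comp A K e.H = L"
    using e.factor_exists[OF L] far_eq_iff L_eq by metis
  \<comment> \<open>\<open>U\<close> after \<open>K\<close> also factors \<open>T\<close> through
    the quotient, so uniqueness of such factors identifies it with
    \<open>coid_functor A B e T\<close>.\<close>
  have "functor_comp A (functor_comp e.Ae U K) e.H = T"
    using functor_comp_assoc[OF e.is_functor_quotient, of U K] K(2) UL by simp
  then have "functor_comp e.Ae U K = coid_functor A B e T"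
    using e.factor_unique[OF is_functor_comp[OF K(1) U]] coid_functor by blast
  then show "\<exists>!K. is_functor e.Ae E K \<and> functor_comp A K e.H = L \<and>
      functor_comp e.Ae U K = coid_functor A B e T"
    using K e.factor_unique by (intro ex1I[of _ K]) auto
next
  have L_inj: "e Y \<cdot>\<^bsub>A\<^esub> f = e Y \<cdot>\<^bsub>A\<^esub> g"
    if fg: "f \<in> hom A X Y" "g \<in> hom A X Y" and eq: "far L f = far L g" for X Y f g
  proof -
    have "far (functor_comp A U L) f = far (functor_comp A U L) g"
      using homD[OF fg(1)] homD[OF fg(2)] eq by simp
    then show ?thesis using far_eq_iff[OF fg] by (simp add: UL)
  qed
  have "equivalence_up_to_retracts e.Ae E K \<and> (idempotent_complete A \<longrightarrow> is_equivalence e.Ae E K)"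
    if K: "is_functor e.Ae E K" "functor_comp A K e.H = L" for K
  proof -
    interpret fully_faithful e.Ae E K
      by (rule e.fully_faithful_factor[OF L K full L_inj])
    interpret full_and_surjective_up_to_retracts e.Ae E K
      by unfold_locales (use retract e.factor_fob[OF K(2)] in force)
    show ?thesis
      using equivalence_up_to_retracts equivalence_if_idempotent_complete
        e.idempotent_complete_coidentifier by blast
  qed
  then show "\<forall>K. is_functor e.Ae E K \<and> functor_comp A K e.H = L \<and>
      functor_comp e.Ae U K = coid_functor A B e T \<longrightarrow>
      equivalence_up_to_retracts e.Ae E K \<and> (idempotent_complete A \<longrightarrow> is_equivalence e.Ae E K)"
    by blast
qed

end

section \<open>Modules, comodules and the comparison functors\<close>

lemma EM_cat_simps [simp]:
  "(X, m) \<in> Ob (EM_cat C T \<mu> \<eta>) \<longleftrightarrow> X \<in> Ob C \<and> m \<in> hom C (fob T X) X \<and>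
    m \<cdot>\<^bsub>C\<^esub> far T m = m \<cdot>\<^bsub>C\<^esub> \<mu> X \<and> m \<cdot>\<^bsub>C\<^esub> \<eta> X = ide C X"
  "((X, m), f, (X', m')) \<in> Arr (EM_cat C T \<mu> \<eta>) \<longleftrightarrow>
    (X, m) \<in> Ob (EM_cat C T \<mu> \<eta>) \<and> (X', m') \<in> Ob (EM_cat C T \<mu> \<eta>) \<and>
    f \<in> hom C X X' \<and> f \<cdot>\<^bsub>C\<^esub> m = m' \<cdot>\<^bsub>C\<^esub> far T f"
  "src (EM_cat C T \<mu> \<eta>) (M, f, N) = M"
  "tgt (EM_cat C T \<mu> \<eta>) (M, f, N) = N"
  "ide (EM_cat C T \<mu> \<eta>) (X, m) = ((X, m), ide C X, (X, m))"
  "(N', g, Q) \<cdot>\<^bsub>EM_cat C T \<mu> \<eta>\<^esub> (M, f, N) = (M, g \<cdot>\<^bsub>C\<^esub> f, Q)"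
  unfolding EM_cat_def by auto

lemma coEM_cat_simps [simp]:
  "(Y, w) \<in> Ob (coEM_cat D W \<delta> \<epsilon>) \<longleftrightarrow> Y \<in> Ob D \<and> w \<in> hom D Y (fob W Y) \<and>
    far W w \<cdot>\<^bsub>D\<^esub> w = \<delta> Y \<cdot>\<^bsub>D\<^esub> w \<and> \<epsilon> Y \<cdot>\<^bsub>D\<^esub> w = ide D Y"
  "((Y, w), f, (Y', w')) \<in> Arr (coEM_cat D W \<delta> \<epsilon>) \<longleftrightarrow>
    (Y, w) \<in> Ob (coEM_cat D W \<delta> \<epsilon>) \<and> (Y', w') \<in> Ob (coEM_cat D W \<delta> \<epsilon>) \<and>
    f \<in> hom D Y Y' \<and> w' \<cdot>\<^bsub>D\<^esub> f = far W f \<cdot>\<^bsub>D\<^esub> w"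
  "src (coEM_cat D W \<delta> \<epsilon>) (M, f, N) = M"
  "tgt (coEM_cat D W \<delta> \<epsilon>) (M, f, N) = N"
  "ide (coEM_cat D W \<delta> \<epsilon>) (Y, w) = ((Y, w), ide D Y, (Y, w))"
  "(N', g, Q) \<cdot>\<^bsub>coEM_cat D W \<delta> \<epsilon>\<^esub> (M, f, N) = (M, g \<cdot>\<^bsub>D\<^esub> f, Q)"
  unfolding coEM_cat_def by auto

lemma category_EM_cat:
  assumes "is_functor C C T"
  shows "category (EM_cat C T \<mu> \<eta>)"
proof -
  interpret functor_between C C T by (rule functor_betweenI) fact
  show ?thesis
    unfolding EM_cat_def
  proof (rule category_tagged_cat[where u = fst], rule dom.category_axioms, goal_cases)
    case (3 X Y Z f g)
    obtain X1 m Y1 n Z1 q where eq: "X = (X1, m)" "Y = (Y1, n)" "Z = (Z1, q)"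
      by (metis prod.exhaust)
    have f: "f \<in> hom C X1 Y1" "f \<cdot>\<^bsub>C\<^esub> m = n \<cdot>\<^bsub>C\<^esub> far T f"
      and g: "g \<in> hom C Y1 Z1" "g \<cdot>\<^bsub>C\<^esub> n = q \<cdot>\<^bsub>C\<^esub> far T g"
      and mnq: "m \<in> hom C (fob T X1) X1" "n \<in> hom C (fob T Y1) Y1" "q \<in> hom C (fob T Z1) Z1"
      using 3 eq by auto
    note [simp] = homD[OF f(1)] homD[OF g(1)] homD[OF mnq(1)] homD[OF mnq(2)] homD[OF mnq(3)]
    have "g \<cdot>\<^bsub>C\<^esub> f \<cdot>\<^bsub>C\<^esub> m = g \<cdot>\<^bsub>C\<^esub> n \<cdot>\<^bsub>C\<^esub> far T f"
      using dom.cmp_assoc[of m f g] dom.cmp_assoc[of "far T f" n g] f(2) by simp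
    also have "\<dots> = q \<cdot>\<^bsub>C\<^esub> far T (g \<cdot>\<^bsub>C\<^esub> f)"
      unfolding g(2) by (simp add: dom.cmp_assoc)
    finally show ?case using dom.cmp_in[OF f(1) g(1)] eq by simp
  qed (auto simp: dom.ide_in dest: homD)
qed

lemma category_coEM_cat:
  assumes "is_functor D D W"
  shows "category (coEM_cat D W \<delta> \<epsilon>)"
proof -
  interpret functor_between D D W by (rule functor_betweenI) fact
  show ?thesis
    unfolding coEM_cat_def
  proof (rule category_tagged_cat[where u = fst], rule dom.category_axioms, goal_cases)
    case (3 X Y Z f g)
    obtain X1 m Y1 n Z1 q where eq: "X = (X1, m)" "Y = (Y1, n)" "Z = (Z1, q)"
      by (metis prod.exhaust)
    have f: "f \<in> hom D X1 Y1" "n \<cdot>\<^bsub>D\<^esub> f = far W f \<cdot>\<^bsub>D\<^esub> m"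
      and g: "g \<in> hom D Y1 Z1" "q \<cdot>\<^bsub>D\<^esub> g = far W g \<cdot>\<^bsub>D\<^esub> n"
      and mnq: "m \<in> hom D X1 (fob W X1)" "n \<in> hom D Y1 (fob W Y1)" "q \<in> hom D Z1 (fob W Z1)"
      using 3 eq by auto
    note [simp] = homD[OF f(1)] homD[OF g(1)] homD[OF mnq(1)] homD[OF mnq(2)] homD[OF mnq(3)]
    have "q \<cdot>\<^bsub>D\<^esub> (g \<cdot>\<^bsub>D\<^esub> f) = far W g \<cdot>\<^bsub>D\<^esub> (n \<cdot>\<^bsub>D\<^esub> f)"
      by (simp add: dom.cmp_assoc g(2))
    also have "\<dots> = far W (g \<cdot>\<^bsub>D\<^esub> f) \<cdot>\<^bsub>D\<^esub> m"
      unfolding f(2) by (simp add: dom.cmp_assoc)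
    finally show ?case using dom.cmp_in[OF f(1) g(1)] eq by simp
  qed (auto simp: dom.ide_in dest: homD)
qed

section \<open>Forgetful functors\<close>

lemma forgetful_simps [simp]:
  "(X, m) \<in> Ob E \<Longrightarrow> fob (forgetful E) (X, m) = X"
  "(M, f, N) \<in> Arr E \<Longrightarrow> far (forgetful E) (M, f, N) = f"
  by (simp_all add: forgetful_def)

lemma is_functor_forgetful_EM:
  assumes "is_functor C C T"
  shows "is_functor (EM_cat C T \<mu> \<eta>) C (forgetful (EM_cat C T \<mu> \<eta>))"
proof -
  interpret E: category "EM_cat C T \<mu> \<eta>" by (rule category_EM_cat) fact
  show ?thesis
  proof (rule is_functorI, goal_cases)
    case (8 f g)
    then show ?case using E.arr_cmp(1)[OF 8] by (cases f; cases g) (simp del: EM_cat_simps(2))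
  qed (use assms E.category_axioms in \<open>auto simp: is_functor_def forgetful_def E.ide_in[THEN homD]\<close>)
qed

lemma is_functor_forgetful_coEM:
  assumes "is_functor D D W"
  shows "is_functor (coEM_cat D W \<delta> \<epsilon>) D (forgetful (coEM_cat D W \<delta> \<epsilon>))"
proof -
  interpret E: category "coEM_cat D W \<delta> \<epsilon>" by (rule category_coEM_cat) fact
  show ?thesis
  proof (rule is_functorI, goal_cases)
    case (8 f g)
    then show ?case using E.arr_cmp(1)[OF 8] by (cases f; cases g) (simp del: coEM_cat_simps(2))
  qed (use assms E.category_axioms in \<open>auto simp: is_functor_def forgetful_def E.ide_in[THEN homD]\<close>)
qed

section \<open>The comparison and cocomparison functors of an adjunction\<close>

locale adjoint_functors = F: functor_between C D F + G: functor_between D C G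
  for C :: "('c, 'cm) cat" and D :: "('d, 'dm) cat"
    and F :: "('c, 'cm, 'd, 'dm) funct" and G :: "('d, 'dm, 'c, 'cm) funct" +
  fixes \<eta> :: "'c \<Rightarrow> 'cm" and \<epsilon> :: "'d \<Rightarrow> 'dm"
  assumes adjunction: "adjunction C D F G \<eta> \<epsilon>"
begin

abbreviation cmp_C (infixl "\<cdot>\<^sub>C" 70) where "g \<cdot>\<^sub>C f \<equiv> g \<cdot>\<^bsub>C\<^esub> f"
abbreviation cmp_D (infixl "\<cdot>\<^sub>D" 70) where "g \<cdot>\<^sub>D f \<equiv> g \<cdot>\<^bsub>D\<^esub> f"
abbreviation Modules where "Modules \<equiv> modules_GF C F G \<eta> \<epsilon>"
abbreviation Comodules where "Comodules \<equiv> comodules_FG D F G \<eta> \<epsilon>"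

lemma eta_hom: "X \<in> Ob C \<Longrightarrow> \<eta> X \<in> hom C X (fob G (fob F X))"
  using adjunction by (auto simp: adjunction_def nat_trans_def)

lemma eps_hom: "Y \<in> Ob D \<Longrightarrow> \<epsilon> Y \<in> hom D (fob F (fob G Y)) Y"
  using adjunction by (auto simp: adjunction_def nat_trans_def)

lemma eta_arr [simp]: "X \<in> Ob C \<Longrightarrow> \<eta> X \<in> Arr C" "X \<in> Ob C \<Longrightarrow> src C (\<eta> X) = X"
  "X \<in> Ob C \<Longrightarrow> tgt C (\<eta> X) = fob G (fob F X)"
  using eta_hom homD by metis+

lemma eps_arr [simp]: "Y \<in> Ob D \<Longrightarrow> \<epsilon> Y \<in> Arr D" "Y \<in> Ob D \<Longrightarrow> tgt D (\<epsilon> Y) = Y"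
  "Y \<in> Ob D \<Longrightarrow> src D (\<epsilon> Y) = fob F (fob G Y)"
  using eps_hom homD by metis+

lemma eta_natural: "f \<in> hom C X X' \<Longrightarrow> \<eta> X' \<cdot>\<^sub>C f = far G (far F f) \<cdot>\<^sub>C \<eta> X"
  using adjunction F.dom.hom_ob homD[of f C X X'] unfolding adjunction_def nat_trans_def by fastforce

lemma eps_natural: "f \<in> hom D Y Y' \<Longrightarrow> \<epsilon> Y' \<cdot>\<^sub>D far F (far G f) = f \<cdot>\<^sub>D \<epsilon> Y"
  using adjunction F.cod.hom_ob homD[of f D Y Y'] unfolding adjunction_def nat_trans_def by fastforce

lemma eps_F_eta [simp]: "X \<in> Ob C \<Longrightarrow> \<epsilon> (fob F X) \<cdot>\<^sub>D far F (\<eta> X) = ide D (fob F X)"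
  using adjunction by (auto simp: adjunction_def)

lemma G_eps_eta [simp]: "Y \<in> Ob D \<Longrightarrow> far G (\<epsilon> Y) \<cdot>\<^sub>C \<eta> (fob G Y) = ide C (fob G Y)"
  using adjunction by (auto simp: adjunction_def)

lemma is_functor_GF: "is_functor C C (functor_comp C G F)"
  and is_functor_FG: "is_functor D D (functor_comp D F G)"
  by (rule is_functor_comp, rule F.is_functor G.is_functor, rule F.is_functor G.is_functor)+

lemma Modules_Ob:
  "(X, m) \<in> Ob Modules \<longleftrightarrow> X \<in> Ob C \<and> m \<in> hom C (fob G (fob F X)) X \<and>
    m \<cdot>\<^sub>C far G (far F m) = m \<cdot>\<^sub>C far G (\<epsilon> (fob F X)) \<and> m \<cdot>\<^sub>C \<eta> X = ide C X"
  by (auto simp: modules_GF_def dest: homD)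

lemma Modules_Arr:
  "((X, m), f, (X', m')) \<in> Arr Modules \<longleftrightarrow> (X, m) \<in> Ob Modules \<and> (X', m') \<in> Ob Modules \<and>
    f \<in> hom C X X' \<and> f \<cdot>\<^sub>C m = m' \<cdot>\<^sub>C far G (far F f)"
  by (auto simp: modules_GF_def dest: homD)

lemma Modules_simps [simp]:
  "src Modules (M, f, N) = M" "tgt Modules (M, f, N) = N"
  "ide Modules (X, m) = ((X, m), ide C X, (X, m))"
  "(N', g, Q) \<cdot>\<^bsub>Modules\<^esub> (M, f, N) = (M, g \<cdot>\<^sub>C f, Q)"
  by (simp_all add: modules_GF_def)

lemma Comodules_Ob:
  "(Y, w) \<in> Ob Comodules \<longleftrightarrow> Y \<in> Ob D \<and> w \<in> hom D Y (fob F (fob G Y)) \<and>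
    far F (far G w) \<cdot>\<^sub>D w = far F (\<eta> (fob G Y)) \<cdot>\<^sub>D w \<and> \<epsilon> Y \<cdot>\<^sub>D w = ide D Y"
  by (auto simp: comodules_FG_def dest: homD)

lemma Comodules_Arr:
  "((Y, w), f, (Y', w')) \<in> Arr Comodules \<longleftrightarrow> (Y, w) \<in> Ob Comodules \<and> (Y', w') \<in> Ob Comodules \<and>
    f \<in> hom D Y Y' \<and> w' \<cdot>\<^sub>D f = far F (far G f) \<cdot>\<^sub>D w"
  by (auto simp: comodules_FG_def dest: homD)

lemma Comodules_simps [simp]:
  "src Comodules (M, f, N) = M" "tgt Comodules (M, f, N) = N"
  "ide Comodules (Y, w) = ((Y, w), ide D Y, (Y, w))"
  "(N', g, Q) \<cdot>\<^bsub>Comodules\<^esub> (M, f, N) = (M, g \<cdot>\<^sub>D f, Q)"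
  by (simp_all add: comodules_FG_def)

lemma category_Modules: "category Modules"
  and is_functor_forgetful_Modules: "is_functor Modules C (forgetful Modules)"
  unfolding modules_GF_def
  by (rule category_EM_cat is_functor_forgetful_EM, rule is_functor_GF)+

lemma category_Comodules: "category Comodules"
  and is_functor_forgetful_Comodules: "is_functor Comodules D (forgetful Comodules)"
  unfolding comodules_FG_def
  by (rule category_coEM_cat is_functor_forgetful_coEM, rule is_functor_FG)+

lemma comparison_fob [simp]: "Y \<in> Ob D \<Longrightarrow> fob (comparison D G \<epsilon>) Y = (fob G Y, far G (\<epsilon> Y))"
  and comparison_far: "f \<in> hom D Y Y' \<Longrightarrow>
    far (comparison D G \<epsilon>) f = ((fob G Y, far G (\<epsilon> Y)), far G f, (fob G Y', far G (\<epsilon> Y')))"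
  by (auto simp: comparison_def hom_def)

lemma cocomparison_fob [simp]: "X \<in> Ob C \<Longrightarrow> fob (cocomparison C F \<eta>) X = (fob F X, far F (\<eta> X))"
  and cocomparison_far: "f \<in> hom C X X' \<Longrightarrow>
    far (cocomparison C F \<eta>) f = ((fob F X, far F (\<eta> X)), far F f, (fob F X', far F (\<eta> X')))"
  by (auto simp: cocomparison_def hom_def)

text \<open>Associativity of the action is \<open>G\<close> applied to naturality of
  \<open>\<epsilon>\<close> at \<open>\<epsilon> Y\<close>; the unit law is a triangle
  identity.\<close>

lemma comparison_Ob: "Y \<in> Ob D \<Longrightarrow> (fob G Y, far G (\<epsilon> Y)) \<in> Ob Modules"
  using eps_natural[OF eps_hom, of Y] by (simp add: Modules_Ob hom_def flip: G.far_cmp)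

lemma comparison_Arr:
  assumes f: "f \<in> hom D Y Y'"
  shows "((fob G Y, far G (\<epsilon> Y)), far G f, (fob G Y', far G (\<epsilon> Y'))) \<in> Arr Modules"
  using eps_natural[OF f] homD[OF f] F.cod.hom_ob[OF f] G.far_hom[OF f]
  by (auto simp: Modules_Arr comparison_Ob simp flip: G.far_cmp)

lemma is_functor_comparison: "is_functor D Modules (comparison D G \<epsilon>)"
proof (rule is_functorI, goal_cases)
  case (5 f)
  then have "f \<in> hom D (src D f) (tgt D f)" by (simp add: hom_def)
  from comparison_far[OF this] comparison_Arr[OF this] 5 show ?case by (simp add: hom_def)
next
  case (7 Y)
  then show ?case using comparison_far[OF F.cod.ide_in[OF 7]] by simp
next
  case (8 f g)
  then show ?case
    using comparison_far[of f "src D f" "tgt D f"] comparison_far[of g "src D g" "tgt D g"]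
      comparison_far[of "g \<cdot>\<^sub>D f" "src D f" "tgt D g"] by (simp add: hom_def)
qed (auto simp: F.cod.category_axioms category_Modules comparison_Ob, auto simp: comparison_def)

lemma forgetful_comparison: "functor_comp D (forgetful Modules) (comparison D G \<epsilon>) = G"
proof (rule funct_eqI[OF is_functor_comp[OF is_functor_comparison is_functor_forgetful_Modules] G.is_functor])
  fix f assume "f \<in> Arr D"
  then show "far (functor_comp D (forgetful Modules) (comparison D G \<epsilon>)) f = far G f"
    using comparison_far[of f "src D f" "tgt D f"] comparison_Arr[of f "src D f" "tgt D f"]
    by (simp add: hom_def)
qed (simp add: comparison_Ob)

text \<open>Coassociativity is \<open>F\<close> applied to naturality of \<open>\<eta>\<close> at
  \<open>\<eta> X\<close>; the counit law is the other triangle identity.\<close>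

lemma cocomparison_Ob: "X \<in> Ob C \<Longrightarrow> (fob F X, far F (\<eta> X)) \<in> Ob Comodules"
  using eta_natural[OF eta_hom, of X] by (simp add: Comodules_Ob hom_def flip: F.far_cmp)

lemma cocomparison_Arr:
  assumes f: "f \<in> hom C X X'"
  shows "((fob F X, far F (\<eta> X)), far F f, (fob F X', far F (\<eta> X'))) \<in> Arr Comodules"
  using eta_natural[OF f] homD[OF f] F.dom.hom_ob[OF f] F.far_hom[OF f]
  by (auto simp: Comodules_Arr cocomparison_Ob simp flip: F.far_cmp)

lemma is_functor_cocomparison: "is_functor C Comodules (cocomparison C F \<eta>)"
proof (rule is_functorI, goal_cases)
  case (5 f)
  then have "f \<in> hom C (src C f) (tgt C f)" by (simp add: hom_def)
  from cocomparison_far[OF this] cocomparison_Arr[OF this] 5 show ?case by (simp add: hom_def)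
next
  case (7 X)
  then show ?case using cocomparison_far[OF F.dom.ide_in[OF 7]] by simp
next
  case (8 f g)
  then show ?case
    using cocomparison_far[of f "src C f" "tgt C f"] cocomparison_far[of g "src C g" "tgt C g"]
      cocomparison_far[of "g \<cdot>\<^sub>C f" "src C f" "tgt C g"] by (simp add: hom_def)
qed (auto simp: F.dom.category_axioms category_Comodules cocomparison_Ob, auto simp: cocomparison_def)

lemma forgetful_cocomparison: "functor_comp C (forgetful Comodules) (cocomparison C F \<eta>) = F"
proof (rule funct_eqI[OF is_functor_comp[OF is_functor_cocomparison is_functor_forgetful_Comodules]
      F.is_functor])
  fix f assume "f \<in> Arr C"
  then show "far (functor_comp C (forgetful Comodules) (cocomparison C F \<eta>)) f = far F f"
    using cocomparison_far[of f "src C f" "tgt C f"] cocomparison_Arr[of f "src C f" "tgt C f"]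
    by (simp add: hom_def)
qed (simp add: cocomparison_Ob)

end

section \<open>Fullness and retracts\<close>

context adjoint_functors
begin

text \<open>The preimage is \<open>P Y Y' g'\<close>. Naturality takes \<open>\<epsilon> Y\<close>
  inside \<open>P\<close>, and linearity of \<open>g'\<close> puts the resulting argument into the
  image of \<open>G\<close>, where applying \<open>P\<close> and then \<open>G\<close> changes
  nothing.\<close>

lemma comparison_full:
  assumes "semiseparable_functor D C G P e" and Y: "Y \<in> Ob D" "Y' \<in> Ob D"
    and g: "g \<in> hom Modules (fob (comparison D G \<epsilon>) Y) (fob (comparison D G \<epsilon>) Y')"
  shows "\<exists>f\<in>hom D Y Y'. far (comparison D G \<epsilon>) f = g"
proof -
  interpret semiseparable_functor D C G P e by fact
  obtain g' where g_eq: "g = ((fob G Y, far G (\<epsilon> Y)), g', (fob G Y', far G (\<epsilon> Y')))"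
    using g Y by (cases g) (auto simp: hom_def)
  then have g': "g' \<in> hom C (fob G Y) (fob G Y')"
    and g'_eps: "g' \<cdot>\<^sub>C far G (\<epsilon> Y) = far G (\<epsilon> Y') \<cdot>\<^sub>C far G (far F g')"
    using g by (auto simp: hom_def Modules_Arr)
  note [simp] = Y homD[OF g']
  let ?f = "P Y Y' g'"
  have f: "?f \<in> hom D Y Y'" using P_hom[OF Y g'] .
  note [simp] = homD[OF f]
  \<comment> \<open>This is the transpose of \<open>g'\<close> under the adjunction; by linearity
    its image under \<open>G\<close> is \<open>g'\<close> after
    \<open>far G (\<epsilon> Y)\<close>.\<close>
  have k: "\<epsilon> Y' \<cdot>\<^sub>D far F g' \<in> hom D (fob F (fob G Y)) Y'" by (simp add: hom_def)
  have Gk: "far G (\<epsilon> Y' \<cdot>\<^sub>D far F g') = g' \<cdot>\<^sub>C far G (\<epsilon> Y)"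
    by (simp add: g'_eps)
  have "?f \<cdot>\<^sub>D \<epsilon> Y = P (fob F (fob G Y)) Y' (g' \<cdot>\<^sub>C far G (\<epsilon> Y))"
    by (rule P_cmp_right[symmetric]) (simp_all add: g' eps_hom)
  then have "far G (?f \<cdot>\<^sub>D \<epsilon> Y) = g' \<cdot>\<^sub>C far G (\<epsilon> Y)"
    using far_P_far[OF k] unfolding Gk by simp
  \<comment> \<open>\<open>far G (\<epsilon> Y)\<close> is cancelled by its section
    \<open>\<eta> (fob G Y)\<close>.\<close>
  then have "far G ?f \<cdot>\<^sub>C far G (\<epsilon> Y) \<cdot>\<^sub>C \<eta> (fob G Y) = g' \<cdot>\<^sub>C far G (\<epsilon> Y) \<cdot>\<^sub>C \<eta> (fob G Y)"
    by simp
  then have "far G ?f \<cdot>\<^sub>C (far G (\<epsilon> Y) \<cdot>\<^sub>C \<eta> (fob G Y)) = g' \<cdot>\<^sub>C (far G (\<epsilon> Y) \<cdot>\<^sub>C \<eta> (fob G Y))"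
    by (simp add: F.dom.cmp_assoc del: G_eps_eta)
  then have "far G ?f = g'" by simp
  then show ?thesis using f comparison_far[OF f] g_eq by auto
qed

text \<open>The action \<open>m\<close> is the retraction from the free module on \<open>X\<close>.
  Its section comes from an endomorphism \<open>h\<close> of \<open>fob F X\<close> whose image
  under \<open>G\<close> is the idempotent \<open>s \<cdot>\<^sub>C m\<close>.\<close>

lemma comparison_retract:
  assumes "semiseparable_functor D C G P e" and M: "M \<in> Ob Modules"
  shows "\<exists>Y\<in>Ob D. \<exists>p\<in>hom Modules (fob (comparison D G \<epsilon>) Y) M.
    \<exists>s\<in>hom Modules M (fob (comparison D G \<epsilon>) Y). p \<cdot>\<^bsub>Modules\<^esub> s = ide Modules M"
proof -
  interpret semiseparable_functor D C G P e by fact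
  obtain X m where M_eq: "M = (X, m)" by fastforce
  have X [simp]: "X \<in> Ob C" and m: "m \<in> hom C (fob G (fob F X)) X"
    and m_assoc: "m \<cdot>\<^sub>C far G (far F m) = m \<cdot>\<^sub>C far G (\<epsilon> (fob F X))"
    and m_eta: "m \<cdot>\<^sub>C \<eta> X = ide C X"
    using M M_eq by (auto simp: Modules_Ob)
  note [simp] = homD[OF m]
  \<comment> \<open>A natural substitute for a section of \<open>\<epsilon>\<close>:
    \<open>\<epsilon> Y \<cdot>\<^sub>D \<gamma> Y\<close> is \<open>e Y\<close>, which
    \<open>G\<close> sends to an identity.\<close>
  define \<gamma> where "\<gamma> Y = P Y (fob F (fob G Y)) (\<eta> (fob G Y))" for Y
  have \<gamma>: "\<gamma> Y \<in> hom D Y (fob F (fob G Y))" if "Y \<in> Ob D" for Y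
    unfolding \<gamma>_def using that by (intro P_hom) (auto simp: eta_hom)
  note [simp] = homD[OF \<gamma>]
  have \<gamma>_natural: "\<gamma> Y' \<cdot>\<^sub>D f = far F (far G f) \<cdot>\<^sub>D \<gamma> Y" if f: "f \<in> hom D Y Y'" for f Y Y'
  proof -
    have Y: "Y \<in> Ob D" "Y' \<in> Ob D" using F.cod.hom_ob[OF f] by auto
    have "\<gamma> Y' \<cdot>\<^sub>D f = P Y (fob F (fob G Y')) (\<eta> (fob G Y') \<cdot>\<^sub>C far G f)"
      unfolding \<gamma>_def by (rule P_cmp_right[symmetric]) (use Y f eta_hom in auto)
    also have "\<dots> = P Y (fob F (fob G Y')) (far G (far F (far G f)) \<cdot>\<^sub>C \<eta> (fob G Y))"
      using eta_natural[OF G.far_hom[OF f]] by simp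
    also have "\<dots> = far F (far G f) \<cdot>\<^sub>D \<gamma> Y"
      unfolding \<gamma>_def by (rule P_cmp_left) (use Y f eta_hom F.far_hom G.far_hom in auto)
    finally show ?thesis .
  qed
  have eps_\<gamma>: "\<epsilon> Y \<cdot>\<^sub>D \<gamma> Y = e Y" if Y: "Y \<in> Ob D" for Y
    using P_cmp_left[OF Y _ eps_hom[OF Y], of "\<eta> (fob G Y)"] Y
    by (simp add: \<gamma>_def e_eq eta_hom)
  define h where "h = far F m \<cdot>\<^sub>D \<gamma> (fob F X)"
  have h: "h \<in> hom D (fob F X) (fob F X)" by (simp add: h_def hom_def)
  note [simp] = homD[OF h]
  \<comment> \<open>The transpose of \<open>h\<close> under the adjunction.\<close>
  define s where "s = far G h \<cdot>\<^sub>C \<eta> X"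
  have s: "s \<in> hom C X (fob G (fob F X))" by (simp add: s_def hom_def)
  note [simp] = homD[OF s]
  \<comment> \<open>Naturality moves \<open>far F m\<close> and \<open>\<epsilon> (fob F X)\<close>
    past \<open>\<gamma>\<close>; between the two moves, associativity of the module exchanges
    them.\<close>
  have h_Fm: "h \<cdot>\<^sub>D far F m = h \<cdot>\<^sub>D \<epsilon> (fob F X)"
  proof -
    have "h \<cdot>\<^sub>D far F m = far F m \<cdot>\<^sub>D (\<gamma> (fob F X) \<cdot>\<^sub>D far F m)"
      by (simp add: h_def F.cod.cmp_assoc)
    also have "\<dots> = far F (m \<cdot>\<^sub>C far G (far F m)) \<cdot>\<^sub>D \<gamma> (fob F (fob G (fob F X)))"
      by (subst \<gamma>_natural[OF F.far_hom[OF m]]) (simp add: F.cod.cmp_assoc)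
    also have "\<dots> = far F m \<cdot>\<^sub>D (far F (far G (\<epsilon> (fob F X))) \<cdot>\<^sub>D \<gamma> (fob F (fob G (fob F X))))"
      unfolding m_assoc by (simp add: F.cod.cmp_assoc)
    also have "\<dots> = h \<cdot>\<^sub>D \<epsilon> (fob F X)"
      by (subst \<gamma>_natural[OF eps_hom, symmetric]) (simp_all add: h_def F.cod.cmp_assoc)
    finally show ?thesis .
  qed
  \<comment> \<open>Naturality of \<open>\<eta>\<close> at \<open>m\<close> produces
    \<open>far F m\<close>, which \<open>h_Fm\<close> trades for a counit that a triangle identity
    cancels.\<close>
  have s_m: "s \<cdot>\<^sub>C m = far G h"
  proof -
    have "s \<cdot>\<^sub>C m = far G h \<cdot>\<^sub>C (\<eta> X \<cdot>\<^sub>C m)" by (simp add: s_def F.dom.cmp_assoc)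
    also have "\<dots> = far G (h \<cdot>\<^sub>D far F m) \<cdot>\<^sub>C \<eta> (fob G (fob F X))"
      by (subst eta_natural[OF m]) (simp add: F.dom.cmp_assoc)
    also have "\<dots> = far G h \<cdot>\<^sub>C (far G (\<epsilon> (fob F X)) \<cdot>\<^sub>C \<eta> (fob G (fob F X)))"
      unfolding h_Fm by (simp add: F.dom.cmp_assoc del: G_eps_eta)
    also have "\<dots> = far G h" by simp
    finally show ?thesis .
  qed
  \<comment> \<open>Associativity again trades \<open>far F m\<close> for the counit, which meets
    \<open>\<gamma>\<close> and leaves \<open>e\<close>, an identity under \<open>G\<close>.\<close>
  have m_Gh: "m \<cdot>\<^sub>C far G h = m"
  proof -
    have "m \<cdot>\<^sub>C far G h = (m \<cdot>\<^sub>C far G (far F m)) \<cdot>\<^sub>C far G (\<gamma> (fob F X))"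
      by (simp add: h_def F.dom.cmp_assoc)
    also have "\<dots> = m \<cdot>\<^sub>C far G (\<epsilon> (fob F X) \<cdot>\<^sub>D \<gamma> (fob F X))"
      unfolding m_assoc by (simp add: F.dom.cmp_assoc)
    finally show ?thesis by (simp add: eps_\<gamma> far_e)
  qed
  have m_s: "m \<cdot>\<^sub>C s = ide C X"
    using m_Gh m_eta by (simp add: s_def F.dom.cmp_assoc)
  \<comment> \<open>Linearity of \<open>s\<close>: both sides equal \<open>far G h\<close>, here by
    naturality of \<open>\<epsilon>\<close> at \<open>h\<close> and a triangle identity.\<close>
  have "far G (\<epsilon> (fob F X)) \<cdot>\<^sub>C far G (far F s)
      = far G (\<epsilon> (fob F X) \<cdot>\<^sub>D far F (far G h)) \<cdot>\<^sub>C far G (far F (\<eta> X))"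
    by (simp add: s_def F.dom.cmp_assoc)
  also have "\<dots> = far G (h \<cdot>\<^sub>D (\<epsilon> (fob F X) \<cdot>\<^sub>D far F (\<eta> X)))"
    unfolding eps_natural[OF h] by (simp add: F.dom.cmp_assoc del: eps_F_eta)
  also have "\<dots> = s \<cdot>\<^sub>C m" by (simp add: s_m)
  finally have s_mod: "s \<cdot>\<^sub>C m = far G (\<epsilon> (fob F X)) \<cdot>\<^sub>C far G (far F s)" by simp
  let ?K = "(fob G (fob F X), far G (\<epsilon> (fob F X)))"
  have K: "?K \<in> Ob Modules" by (simp add: comparison_Ob)
  \<comment> \<open>Linearity of \<open>m\<close>, as a map out of the free module, is its
    associativity law.\<close>
  have p_hom: "(?K, m, M) \<in> hom Modules ?K M"
    using K M m m_assoc unfolding M_eq by (intro homI) (simp_all add: Modules_Arr)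
  have s_hom: "(M, s, ?K) \<in> hom Modules M ?K"
    using K M s s_mod unfolding M_eq by (intro homI) (simp_all add: Modules_Arr)
  have "(?K, m, M) \<cdot>\<^bsub>Modules\<^esub> (M, s, ?K) = ide Modules M"
    using m_s by (simp add: M_eq)
  then have "\<exists>p\<in>hom Modules ?K M. \<exists>s\<in>hom Modules M ?K. p \<cdot>\<^bsub>Modules\<^esub> s = ide Modules M"
    using p_hom s_hom by blast
  then show ?thesis by (intro bexI[of _ "fob F X"]) simp_all
qed

text \<open>Dual to \<open>comparison_full\<close>: \<open>\<eta> X'\<close> is taken inside
  \<open>P\<close> from the left, and colinearity puts the argument into the image of
  \<open>F\<close>.\<close>

lemma cocomparison_full:
  assumes "semiseparable_functor C D F P e" and X: "X \<in> Ob C" "X' \<in> Ob C"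
    and g: "g \<in> hom Comodules (fob (cocomparison C F \<eta>) X) (fob (cocomparison C F \<eta>) X')"
  shows "\<exists>f\<in>hom C X X'. far (cocomparison C F \<eta>) f = g"
proof -
  interpret semiseparable_functor C D F P e by fact
  obtain g' where g_eq: "g = ((fob F X, far F (\<eta> X)), g', (fob F X', far F (\<eta> X')))"
    using g X by (cases g) (auto simp: hom_def)
  then have g': "g' \<in> hom D (fob F X) (fob F X')"
    and g'_eta: "far F (\<eta> X') \<cdot>\<^sub>D g' = far F (far G g') \<cdot>\<^sub>D far F (\<eta> X)"
    using g by (auto simp: hom_def Comodules_Arr)
  note [simp] = X homD[OF g']
  let ?f = "P X X' g'"
  have f: "?f \<in> hom C X X'" using P_hom[OF X g'] .
  note [simp] = homD[OF f]
  have k: "far G g' \<cdot>\<^sub>C \<eta> X \<in> hom C X (fob G (fob F X'))" by (simp add: hom_def)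
  have Fk: "far F (far G g' \<cdot>\<^sub>C \<eta> X) = far F (\<eta> X') \<cdot>\<^sub>D g'"
    by (simp add: g'_eta)
  have "\<eta> X' \<cdot>\<^sub>C ?f = P X (fob G (fob F X')) (far F (\<eta> X') \<cdot>\<^sub>D g')"
    by (rule P_cmp_left[symmetric]) (simp_all add: g' eta_hom)
  then have "far F (\<eta> X' \<cdot>\<^sub>C ?f) = far F (\<eta> X') \<cdot>\<^sub>D g'"
    using far_P_far[OF k] unfolding Fk by simp
  \<comment> \<open>\<open>far F (\<eta> X')\<close> is cancelled by its retraction
    \<open>\<epsilon> (fob F X')\<close>.\<close>
  then have "\<epsilon> (fob F X') \<cdot>\<^sub>D (far F (\<eta> X') \<cdot>\<^sub>D far F ?f) = \<epsilon> (fob F X') \<cdot>\<^sub>D (far F (\<eta> X') \<cdot>\<^sub>D g')"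
    by simp
  then have "far F ?f = g'" by (simp add: F.cod.cmp_assoc)
  then show ?thesis using f cocomparison_far[OF f] g_eq by auto
qed

text \<open>The roles of section and retraction are exchanged: the coaction \<open>w\<close> is the
  section into the cofree comodule on \<open>Y\<close>, and the retraction \<open>r\<close> has to
  be constructed, so that \<open>w \<cdot>\<^sub>D r\<close> is the image under \<open>F\<close> of
  an endomorphism \<open>h\<close>.\<close>

lemma cocomparison_retract:
  assumes "semiseparable_functor C D F P e" and M: "M \<in> Ob Comodules"
  shows "\<exists>X\<in>Ob C. \<exists>p\<in>hom Comodules (fob (cocomparison C F \<eta>) X) M.
    \<exists>s\<in>hom Comodules M (fob (cocomparison C F \<eta>) X). p \<cdot>\<^bsub>Comodules\<^esub> s = ide Comodules M"
proof -
  interpret semiseparable_functor C D F P e by fact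
  obtain Y w where M_eq: "M = (Y, w)" by fastforce
  have Y [simp]: "Y \<in> Ob D" and w: "w \<in> hom D Y (fob F (fob G Y))"
    and w_coassoc: "far F (far G w) \<cdot>\<^sub>D w = far F (\<eta> (fob G Y)) \<cdot>\<^sub>D w"
    and eps_w: "\<epsilon> Y \<cdot>\<^sub>D w = ide D Y"
    using M M_eq by (auto simp: Comodules_Ob)
  note [simp] = homD[OF w]
  \<comment> \<open>Now a natural substitute for a retraction of \<open>\<eta>\<close>:
    \<open>\<gamma> X \<cdot>\<^sub>C \<eta> X\<close> is \<open>e X\<close>, which \<open>F\<close>
    sends to an identity.\<close>
  define \<gamma> where "\<gamma> X = P (fob G (fob F X)) X (\<epsilon> (fob F X))" for X
  have \<gamma>: "\<gamma> X \<in> hom C (fob G (fob F X)) X" if "X \<in> Ob C" for X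
    unfolding \<gamma>_def using that by (intro P_hom) (auto simp: eps_hom)
  note [simp] = homD[OF \<gamma>]
  have \<gamma>_natural: "\<gamma> X' \<cdot>\<^sub>C far G (far F f) = f \<cdot>\<^sub>C \<gamma> X" if f: "f \<in> hom C X X'" for f X X'
  proof -
    have X: "X \<in> Ob C" "X' \<in> Ob C" using F.dom.hom_ob[OF f] by auto
    have "\<gamma> X' \<cdot>\<^sub>C far G (far F f) = P (fob G (fob F X)) X' (\<epsilon> (fob F X') \<cdot>\<^sub>D far F (far G (far F f)))"
      unfolding \<gamma>_def by (rule P_cmp_right[symmetric]) (use X f eps_hom G.far_hom F.far_hom in auto)
    also have "\<dots> = P (fob G (fob F X)) X' (far F f \<cdot>\<^sub>D \<epsilon> (fob F X))"
      using eps_natural[OF F.far_hom[OF f]] by simp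
    also have "\<dots> = f \<cdot>\<^sub>C \<gamma> X"
      unfolding \<gamma>_def by (rule P_cmp_left) (use X f eps_hom in auto)
    finally show ?thesis .
  qed
  have \<gamma>_eta: "\<gamma> X \<cdot>\<^sub>C \<eta> X = e X" if X: "X \<in> Ob C" for X
    using P_cmp_right[OF X _ eta_hom[OF X], of "\<epsilon> (fob F X)"] X
    by (simp add: \<gamma>_def e_eq eps_hom)
  define h where "h = \<gamma> (fob G Y) \<cdot>\<^sub>C far G w"
  have h: "h \<in> hom C (fob G Y) (fob G Y)" by (simp add: h_def hom_def)
  note [simp] = homD[OF h]
  \<comment> \<open>The transpose of \<open>h\<close> under the adjunction.\<close>
  define r where "r = \<epsilon> Y \<cdot>\<^sub>D far F h"
  have r: "r \<in> hom D (fob F (fob G Y)) Y" by (simp add: r_def hom_def)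
  note [simp] = homD[OF r]
  \<comment> \<open>Naturality of \<open>\<gamma>\<close> at \<open>far G w\<close> and at
    \<open>\<eta> (fob G Y)\<close>, with coassociativity applied in between.\<close>
  have Gw_h: "far G w \<cdot>\<^sub>C h = \<eta> (fob G Y) \<cdot>\<^sub>C h"
  proof -
    have "far G w \<cdot>\<^sub>C h = far G w \<cdot>\<^sub>C \<gamma> (fob G Y) \<cdot>\<^sub>C far G w"
      by (simp add: h_def F.dom.cmp_assoc)
    also have "\<dots> = \<gamma> (fob G (fob F (fob G Y))) \<cdot>\<^sub>C far G (far F (far G w) \<cdot>\<^sub>D w)"
      by (subst \<gamma>_natural[OF G.far_hom[OF w], symmetric]) (simp add: F.dom.cmp_assoc)
    also have "\<dots> = \<gamma> (fob G (fob F (fob G Y))) \<cdot>\<^sub>C far G (far F (\<eta> (fob G Y))) \<cdot>\<^sub>C far G w"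
      unfolding w_coassoc by (simp add: F.dom.cmp_assoc)
    also have "\<dots> = \<eta> (fob G Y) \<cdot>\<^sub>C h"
      by (subst \<gamma>_natural[OF eta_hom]) (simp_all add: h_def F.dom.cmp_assoc)
    finally show ?thesis .
  qed
  have w_r: "w \<cdot>\<^sub>D r = far F h"
  proof -
    have "w \<cdot>\<^sub>D r = (w \<cdot>\<^sub>D \<epsilon> Y) \<cdot>\<^sub>D far F h" by (simp add: r_def F.cod.cmp_assoc)
    also have "\<dots> = \<epsilon> (fob F (fob G Y)) \<cdot>\<^sub>D far F (far G w \<cdot>\<^sub>C h)"
      unfolding eps_natural[OF w, symmetric] by (simp add: F.cod.cmp_assoc)
    also have "\<dots> = (\<epsilon> (fob F (fob G Y)) \<cdot>\<^sub>D far F (\<eta> (fob G Y))) \<cdot>\<^sub>D far F h"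
      unfolding Gw_h by (simp add: F.cod.cmp_assoc del: eps_F_eta)
    also have "\<dots> = far F h" by simp
    finally show ?thesis .
  qed
  \<comment> \<open>Coassociativity trades \<open>far F (far G w)\<close> for
    \<open>far F (\<eta> (fob G Y))\<close>, which meets \<open>\<gamma>\<close> and leaves
    \<open>e\<close>, an identity under \<open>F\<close>.\<close>
  have Fh_w: "far F h \<cdot>\<^sub>D w = w"
  proof -
    have "far F h \<cdot>\<^sub>D w = far F (\<gamma> (fob G Y)) \<cdot>\<^sub>D (far F (far G w) \<cdot>\<^sub>D w)"
      by (simp add: h_def F.cod.cmp_assoc)
    also have "\<dots> = far F (\<gamma> (fob G Y) \<cdot>\<^sub>C \<eta> (fob G Y)) \<cdot>\<^sub>D w"
      unfolding w_coassoc by (simp add: F.cod.cmp_assoc)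
    finally show ?thesis by (simp add: \<gamma>_eta far_e)
  qed
  have "r \<cdot>\<^sub>D w = \<epsilon> Y \<cdot>\<^sub>D (far F h \<cdot>\<^sub>D w)"
    by (simp add: r_def F.cod.cmp_assoc)
  then have r_w: "r \<cdot>\<^sub>D w = ide D Y" by (simp add: Fh_w eps_w)
  \<comment> \<open>Colinearity of \<open>r\<close>: both sides equal \<open>far F h\<close>, here
    by naturality of \<open>\<eta>\<close> at \<open>h\<close> and a triangle identity.\<close>
  have "far F (far G r) \<cdot>\<^sub>D far F (\<eta> (fob G Y))
      = far F (far G (\<epsilon> Y)) \<cdot>\<^sub>D far F (far G (far F h) \<cdot>\<^sub>C \<eta> (fob G Y))"
    by (simp add: r_def F.cod.cmp_assoc)
  also have "\<dots> = far F (far G (\<epsilon> Y) \<cdot>\<^sub>C \<eta> (fob G Y)) \<cdot>\<^sub>D far F h"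
    unfolding eta_natural[OF h, symmetric] by (simp add: F.cod.cmp_assoc del: G_eps_eta)
  also have "\<dots> = w \<cdot>\<^sub>D r" by (simp add: w_r)
  finally have r_comod: "w \<cdot>\<^sub>D r = far F (far G r) \<cdot>\<^sub>D far F (\<eta> (fob G Y))" by simp
  let ?K = "(fob F (fob G Y), far F (\<eta> (fob G Y)))"
  have K: "?K \<in> Ob Comodules" by (simp add: cocomparison_Ob)
  have r_hom: "(?K, r, M) \<in> hom Comodules ?K M"
    using K M r r_comod unfolding M_eq by (intro homI) (simp_all add: Comodules_Arr)
  have w_hom: "(M, w, ?K) \<in> hom Comodules M ?K"
    using K M w w_coassoc unfolding M_eq by (intro homI) (simp_all add: Comodules_Arr)
  have "(?K, r, M) \<cdot>\<^bsub>Comodules\<^esub> (M, w, ?K) = ide Comodules M"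
    using r_w by (simp add: M_eq)
  then have "\<exists>p\<in>hom Comodules ?K M. \<exists>s\<in>hom Comodules M ?K. p \<cdot>\<^bsub>Comodules\<^esub> s = ide Comodules M"
    using r_hom w_hom by blast
  then show ?thesis by (intro bexI[of _ "fob G Y"]) simp_all
qed

end

text \<open>The \<open>P\<close> obtained is the one hidden in \<open>associated_idempotent\<close>,
  so that \<open>e\<close> is computed from it.\<close>

lemma semiseparable_functorI:
  assumes "semiseparable A B T" "associated_idempotent A B T e"
  obtains P where "semiseparable_functor A B T P e"
proof -
  obtain P where "semiseparating A B T P" "\<forall>X\<in>Ob A. e X = P X X (ide B (fob T X))"
    using assms(2) unfolding associated_idempotent_def by blast
  moreover have "functor_between A B T"
    using assms(1) functor_betweenI unfolding semiseparable_def by blast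
  ultimately have "semiseparable_functor A B T P e"
    by (simp add: semiseparable_functor_def semiseparable_functor_axioms_def)
  then show thesis by (rule that)
qed

theorem proposition3p17:
  fixes C :: "('c, 'cm) cat" and D :: "('d, 'dm) cat"
    and F :: "('c, 'cm, 'd, 'dm) funct" and G :: "('d, 'dm, 'c, 'cm) funct"
    and \<eta> :: "'c \<Rightarrow> 'cm" and \<epsilon> :: "'d \<Rightarrow> 'dm"
  assumes "adjunction C D F G \<eta> \<epsilon>"
  shows
    "(\<forall>e. semiseparable D C G \<and> associated_idempotent D C G e \<longrightarrow>
        (\<exists>!K. is_functor (coidentifier D e) (modules_GF C F G \<eta> \<epsilon>) K \<and>
              functor_comp D K (quotient_functor D e) = comparison D G \<epsilon> \<and>
              functor_comp (coidentifier D e) (forgetful (modules_GF C F G \<eta> \<epsilon>)) K = coid_functor D C e G) \<and>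
        (\<forall>K. is_functor (coidentifier D e) (modules_GF C F G \<eta> \<epsilon>) K \<and>
             functor_comp D K (quotient_functor D e) = comparison D G \<epsilon> \<and>
             functor_comp (coidentifier D e) (forgetful (modules_GF C F G \<eta> \<epsilon>)) K = coid_functor D C e G \<longrightarrow>
           equivalence_up_to_retracts (coidentifier D e) (modules_GF C F G \<eta> \<epsilon>) K \<and>
           (idempotent_complete D \<longrightarrow>
              is_equivalence (coidentifier D e) (modules_GF C F G \<eta> \<epsilon>) K)))
     \<and>
     (\<forall>e. semiseparable C D F \<and> associated_idempotent C D F e \<longrightarrow>
        (\<exists>!K. is_functor (coidentifier C e) (comodules_FG D F G \<eta> \<epsilon>) K \<and>
              functor_comp C K (quotient_functor C e) = cocomparison C F \<eta> \<and>
              functor_comp (coidentifier C e) (forgetful (comodules_FG D F G \<eta> \<epsilon>)) K = coid_functor C D e F) \<and>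
        (\<forall>K. is_functor (coidentifier C e) (comodules_FG D F G \<eta> \<epsilon>) K \<and>
             functor_comp C K (quotient_functor C e) = cocomparison C F \<eta> \<and>
             functor_comp (coidentifier C e) (forgetful (comodules_FG D F G \<eta> \<epsilon>)) K = coid_functor C D e F \<longrightarrow>
           equivalence_up_to_retracts (coidentifier C e) (comodules_FG D F G \<eta> \<epsilon>) K \<and>
           (idempotent_complete C \<longrightarrow>
              is_equivalence (coidentifier C e) (comodules_FG D F G \<eta> \<epsilon>) K)))"
proof -
  interpret adjoint_functors C D F G \<eta> \<epsilon>
    using assms
    by (auto simp: adjoint_functors_def adjoint_functors_axioms_def adjunction_def intro: functor_betweenI)
  show ?thesis
  proof (intro conjI[of "\<forall>e. _ e" "\<forall>e. _ e"] allI impI; (elim conjE)?)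
    fix e assume "semiseparable D C G" "associated_idempotent D C G e"
    then obtain P where P: "semiseparable_functor D C G P e" by (rule semiseparable_functorI)
    \<comment> \<open>Arrows of \<open>D\<close> with common source and target and equal images
      under \<open>G\<close> have equal images under the comparison functor, which only tags them
      with source and target modules.\<close>
    show "(\<exists>!K. is_functor (coidentifier D e) Modules K \<and>
              functor_comp D K (quotient_functor D e) = comparison D G \<epsilon> \<and>
              functor_comp (coidentifier D e) (forgetful Modules) K = coid_functor D C e G) \<and>
        (\<forall>K. is_functor (coidentifier D e) Modules K \<and>
             functor_comp D K (quotient_functor D e) = comparison D G \<epsilon> \<and>
             functor_comp (coidentifier D e) (forgetful Modules) K = coid_functor D C e G \<longrightarrow>
           equivalence_up_to_retracts (coidentifier D e) Modules K \<and>
           (idempotent_complete D \<longrightarrow> is_equivalence (coidentifier D e) Modules K))"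
      by (rule semiseparable_functor.lift_to_coidentifier[OF P is_functor_comparison
            is_functor_forgetful_Modules forgetful_comparison _ comparison_full[OF P] comparison_retract[OF P]])
        (auto simp: comparison_far)
  next
    fix e assume "semiseparable C D F" "associated_idempotent C D F e"
    then obtain P where P: "semiseparable_functor C D F P e" by (rule semiseparable_functorI)
    show "(\<exists>!K. is_functor (coidentifier C e) Comodules K \<and>
              functor_comp C K (quotient_functor C e) = cocomparison C F \<eta> \<and>
              functor_comp (coidentifier C e) (forgetful Comodules) K = coid_functor C D e F) \<and>
        (\<forall>K. is_functor (coidentifier C e) Comodules K \<and>
             functor_comp C K (quotient_functor C e) = cocomparison C F \<eta> \<and>
             functor_comp (coidentifier C e) (forgetful Comodules) K = coid_functor C D e F \<longrightarrow>
           equivalence_up_to_retracts (coidentifier C e) Comodules K \<and>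
           (idempotent_complete C \<longrightarrow> is_equivalence (coidentifier C e) Comodules K))"
      by (rule semiseparable_functor.lift_to_coidentifier[OF P is_functor_cocomparison
            is_functor_forgetful_Comodules forgetful_cocomparison _ cocomparison_full[OF P] cocomparison_retract[OF P]])
        (auto simp: cocomparison_far)
  qed
qed

end
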